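(* For $\varepsilon>0$ let $\widetilde P^\varepsilon$ be the law on $C(\mathbb R_+,C)$ of the process $(W_t)_{t\ge0}=((|X_t|^2,|X_t|_{-1}^2))_{t\ge0}$ under $\widetilde{\mathbb P}^\varepsilon$. Then the family $\{\widetilde P^\varepsilon:\varepsilon>0\}$ is tight.
   Context: Let $n\ge4$, $N=2n$, and let $1=\lambda_1=\lambda_2<\lambda_3=\lambda_4<\dots<\lambda_{N-1}=\lambda_N$ be reals. On $\mathbb R^N$ put $\langle x,y\rangle=\sum_\ell x_\ell y_\ell$, $|x|^2=\sum_\ell x_\ell^2$, $\langle x,y\rangle_{-1}=\sum_\ell x_\ell y_\ell/\lambda_\ell$, $|x|_{-1}^2=\sum_\ell x_\ell^2/\lambda_\ell$. Fix $a>0$, $\delta_1,\dots,\delta_N\in(-1,0]$ with $\delta_{2i}=\delta_{2i-1}$, and $\widetilde L=\sum_\ell\lambda_\ell(\tfrac a2(1+\delta_\ell)\partial_\ell^2-x_\ell\partial_\ell)$. Let $b:\mathbb R^N\to\mathbb R^N$ with each $b(x)_\ell$ a quadratic form in $x$, $\operatorname{div}b=0$, $\langle x,b(x)\rangle=0=\langle x,b(x)\rangle_{-1}$; $B=\sum_\ell b(x)_\ell\partial_\ell$. Let $\mathcal J$ be the set of triples $J=(k,\ell,m)$ in $\{1,\dots,N\}$ with $\lambda_k<\lambda_\ell<\lambda_m$; $T_J=\sum x_ax_b(1/\lambda_a-1/\lambda_b)\partial_c$ (sum over the three cyclic permutations $(a,b,c)$ of $J$); $R_i=x_{2i}\partial_{2i-1}-x_{2i-1}\partial_{2i}$,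 $1\le i\le n$; enumerate these as $Z_1,\dots,Z_M$ and set $\mathcal D=\frac12\sum_m Z_m^2$. Fix $\kappa\in(0,1]$; for $\varepsilon>0$, $\widetilde{\mathcal L}^\varepsilon=\widetilde L+\varepsilon^{-1}(B+\kappa\mathcal D)$. It is known that the martingale problem for $\widetilde{\mathcal L}^\varepsilon$ on $C(\mathbb R_+,\mathbb R^N)$ (canonical process $(X_t)$) is well posed from every starting point $x$, giving laws $\widetilde{\mathbb P}^\varepsilon_x$ that form a strong Markov process with a unique stationary probability $\widetilde\mu_\varepsilon$; $\widetilde{\mathbb P}^\varepsilon=\int\widetilde\mu_\varepsilon(dx)\widetilde{\mathbb P}^\varepsilon_x$. $C=\{(u,v)\in\mathbb R^2:0\le v\le u\le\lambda_Nv\}$, and $C(\mathbb R_+,C)$ carries the topology of uniform convergence on compact intervals. *)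

theory Defs
  imports "HOL-Analysis.Analysis" "HOL-Probability.Probability"
begin

text \<open>Points of R^N, N = 2n, are represented as functions nat => real whose
  coordinates outside {1..2n} vanish (the set Estate n).\<close>

definition Estate :: "nat \<Rightarrow> (nat \<Rightarrow> real) set" where
  "Estate n = {x. \<forall>l. l \<notin> {1..2*n} \<longrightarrow> x l = 0}"

definition sqnorm :: "nat \<Rightarrow> (nat \<Rightarrow> real) \<Rightarrow> real" where
  "sqnorm n x = (\<Sum>l\<in>{1..2*n}. (x l)^2)"

definition sqnorm_m1 :: "nat \<Rightarrow> (nat \<Rightarrow> real) \<Rightarrow> (nat \<Rightarrow> real) \<Rightarrow> real" where
  "sqnorm_m1 n lam x = (\<Sum>l\<in>{1..2*n}. (x l)^2 / lam l)"

definition inner0 :: "nat \<Rightarrow> (nat \<Rightarrow> real) \<Rightarrow> (nat \<Rightarrow> real) \<Rightarrow> real" where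
  "inner0 n x y = (\<Sum>l\<in>{1..2*n}. x l * y l)"

definition inner_m1 :: "nat \<Rightarrow> (nat \<Rightarrow> real) \<Rightarrow> (nat \<Rightarrow> real) \<Rightarrow> (nat \<Rightarrow> real) \<Rightarrow> real" where
  "inner_m1 n lam x y = (\<Sum>l\<in>{1..2*n}. x l * y l / lam l)"

definition pd :: "nat \<Rightarrow> ((nat \<Rightarrow> real) \<Rightarrow> real) \<Rightarrow> (nat \<Rightarrow> real) \<Rightarrow> real" where
  "pd l f x = deriv (\<lambda>t. f (x(l := x l + t))) 0"

definition has_pd :: "nat \<Rightarrow> ((nat \<Rightarrow> real) \<Rightarrow> real) \<Rightarrow> (nat \<Rightarrow> real) \<Rightarrow> bool" where
  "has_pd l f x \<longleftrightarrow> (\<lambda>t. f (x(l := x l + t))) differentiable (at 0)"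

definition testfun :: "nat \<Rightarrow> ((nat \<Rightarrow> real) \<Rightarrow> real) \<Rightarrow> bool" where
  "testfun n f \<longleftrightarrow>
     continuous_on (Estate n) f \<and>
     (\<forall>l\<in>{1..2*n}. \<forall>x\<in>Estate n. has_pd l f x) \<and>
     (\<forall>l\<in>{1..2*n}. continuous_on (Estate n) (pd l f)) \<and>
     (\<forall>l\<in>{1..2*n}. \<forall>m\<in>{1..2*n}. \<forall>x\<in>Estate n. has_pd m (pd l f) x) \<and>
     (\<forall>l\<in>{1..2*n}. \<forall>m\<in>{1..2*n}. continuous_on (Estate n) (pd m (pd l f))) \<and>
     (\<exists>R. \<forall>x\<in>Estate n. sqnorm n x > R \<longrightarrow> f x = 0)"

definition vf :: "nat \<Rightarrow> ((nat \<Rightarrow> real) \<Rightarrow> nat \<Rightarrow> real) \<Rightarrow> ((nat \<Rightarrow> real) \<Rightarrow> real) \<Rightarrow> (nat \<Rightarrow> real) \<Rightarrow> real" where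
  "vf n c f x = (\<Sum>l\<in>{1..2*n}. c x l * pd l f x)"

definition divergence :: "nat \<Rightarrow> ((nat \<Rightarrow> real) \<Rightarrow> nat \<Rightarrow> real) \<Rightarrow> (nat \<Rightarrow> real) \<Rightarrow> real" where
  "divergence n b x = (\<Sum>l\<in>{1..2*n}. pd l (\<lambda>y. b y l) x)"

definition Jset :: "nat \<Rightarrow> (nat \<Rightarrow> real) \<Rightarrow> (nat \<times> nat \<times> nat) set" where
  "Jset n lam = {(k,l,m). k \<in> {1..2*n} \<and> l \<in> {1..2*n} \<and> m \<in> {1..2*n} \<and>
                   lam k < lam l \<and> lam l < lam m}"

definition cyc_term :: "(nat \<Rightarrow> real) \<Rightarrow> nat \<Rightarrow> nat \<Rightarrow> nat \<Rightarrow> (nat \<Rightarrow> real) \<Rightarrow> nat \<Rightarrow> real" where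
  "cyc_term lam a b c x j = (if j = c then x a * x b * (1 / lam a - 1 / lam b) else 0)"

definition Tfield :: "(nat \<Rightarrow> real) \<Rightarrow> nat \<times> nat \<times> nat \<Rightarrow> (nat \<Rightarrow> real) \<Rightarrow> nat \<Rightarrow> real" where
  "Tfield lam J x j = (case J of (k,l,m) \<Rightarrow>
      cyc_term lam k l m x j + cyc_term lam l m k x j + cyc_term lam m k l x j)"

definition Rfield :: "nat \<Rightarrow> (nat \<Rightarrow> real) \<Rightarrow> nat \<Rightarrow> real" where
  "Rfield i x j = (if j = 2*i - 1 then x (2*i) else if j = 2*i then - x (2*i - 1) else 0)"

definition Dop :: "nat \<Rightarrow> (nat \<Rightarrow> real) \<Rightarrow> ((nat \<Rightarrow> real) \<Rightarrow> real) \<Rightarrow> (nat \<Rightarrow> real) \<Rightarrow> real" where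
  "Dop n lam f x = (1/2) * ((\<Sum>J\<in>Jset n lam. vf n (Tfield lam J) (vf n (Tfield lam J) f) x)
                         + (\<Sum>i\<in>{1..n}. vf n (Rfield i) (vf n (Rfield i) f) x))"

definition Ltilde :: "nat \<Rightarrow> (nat \<Rightarrow> real) \<Rightarrow> real \<Rightarrow> (nat \<Rightarrow> real) \<Rightarrow> ((nat \<Rightarrow> real) \<Rightarrow> real) \<Rightarrow> (nat \<Rightarrow> real) \<Rightarrow> real" where
  "Ltilde n lam a \<delta> f x = (\<Sum>l\<in>{1..2*n}.
      lam l * (a / 2 * (1 + \<delta> l) * pd l (pd l f) x - x l * pd l f x))"

definition Lgen :: "nat \<Rightarrow> (nat \<Rightarrow> real) \<Rightarrow> real \<Rightarrow> (nat \<Rightarrow> real) \<Rightarrow> ((nat \<Rightarrow> real) \<Rightarrow> nat \<Rightarrow> real)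
     \<Rightarrow> real \<Rightarrow> real \<Rightarrow> ((nat \<Rightarrow> real) \<Rightarrow> real) \<Rightarrow> (nat \<Rightarrow> real) \<Rightarrow> real" where
  "Lgen n lam a \<delta> b \<kappa> \<epsilon> f x =
     Ltilde n lam a \<delta> f x + (1 / \<epsilon>) * (vf n b f x + \<kappa> * Dop n lam f x)"

text \<open>Path space C(R_+, R^N): continuous paths with values in Estate n,
  extended constantly to negative times; sigma-algebra generated by the
  coordinate maps at times in T.\<close>
definition Paths :: "nat \<Rightarrow> (real \<Rightarrow> nat \<Rightarrow> real) set" where
  "Paths n = {\<omega>. continuous_on UNIV \<omega> \<and> (\<forall>t. \<omega> t \<in> Estate n) \<and> (\<forall>t\<le>0. \<omega> t = \<omega> 0)}"

definition coord_sigma :: "nat \<Rightarrow> real set \<Rightarrow> (real \<Rightarrow> nat \<Rightarrow> real) measure" where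
  "coord_sigma n T = sigma (Paths n)
     {{\<omega> \<in> Paths n. \<omega> s l \<in> A} | s l A. s \<in> T \<and> A \<in> sets borel}"

abbreviation PathSpace :: "nat \<Rightarrow> (real \<Rightarrow> nat \<Rightarrow> real) measure" where
  "PathSpace n \<equiv> coord_sigma n {0..}"

definition mart_fun :: "(((nat \<Rightarrow> real) \<Rightarrow> real) \<Rightarrow> (nat \<Rightarrow> real) \<Rightarrow> real) \<Rightarrow> ((nat \<Rightarrow> real) \<Rightarrow> real)
     \<Rightarrow> real \<Rightarrow> (real \<Rightarrow> nat \<Rightarrow> real) \<Rightarrow> real" where
  "mart_fun L f t \<omega> = f (\<omega> t) - f (\<omega> 0) - interval_lebesgue_integral lborel 0 (ereal t) (\<lambda>r. L f (\<omega> r))"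

definition solves_MP :: "nat \<Rightarrow> (((nat \<Rightarrow> real) \<Rightarrow> real) \<Rightarrow> (nat \<Rightarrow> real) \<Rightarrow> real)
     \<Rightarrow> (real \<Rightarrow> nat \<Rightarrow> real) measure \<Rightarrow> bool" where
  "solves_MP n L P \<longleftrightarrow> prob_space P \<and> sets P = sets (PathSpace n) \<and>
     (\<forall>f. testfun n f \<longrightarrow>
        (\<forall>t\<ge>0. integrable P (mart_fun L f t)) \<and>
        (\<forall>s t. 0 \<le> s \<and> s \<le> t \<longrightarrow> (\<forall>A \<in> sets (coord_sigma n {0..s}).
            set_lebesgue_integral P A (mart_fun L f t) = set_lebesgue_integral P A (mart_fun L f s))))"

definition stationary_solution :: "nat \<Rightarrow> (((nat \<Rightarrow> real) \<Rightarrow> real) \<Rightarrow> (nat \<Rightarrow> real) \<Rightarrow> real)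
     \<Rightarrow> (real \<Rightarrow> nat \<Rightarrow> real) measure \<Rightarrow> bool" where
  "stationary_solution n L P \<longleftrightarrow> solves_MP n L P \<and>
     (\<forall>t\<ge>0. distr P borel (\<lambda>\<omega>. \<omega> t) = distr P borel (\<lambda>\<omega>. \<omega> 0))"

definition Cone :: "nat \<Rightarrow> (nat \<Rightarrow> real) \<Rightarrow> (real \<times> real) set" where
  "Cone n lam = {(u,v). 0 \<le> v \<and> v \<le> u \<and> u \<le> lam (2*n) * v}"

definition CPaths :: "(real \<times> real) set \<Rightarrow> (real \<Rightarrow> real \<times> real) set" where
  "CPaths S = {w. continuous_on UNIV w \<and> (\<forall>t. w t \<in> S) \<and> (\<forall>t\<le>0. w t = w 0)}"

definition luc_topology :: "(real \<Rightarrow> real \<times> real) set \<Rightarrow> (real \<Rightarrow> real \<times> real) topology" where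
  "luc_topology Q = topology_generated_by
     {{v \<in> Q. \<forall>t\<in>{0..T}. dist (v t) (u t) < r} | u T r. u \<in> Q \<and> T > 0 \<and> r > 0}"

definition Wmap :: "nat \<Rightarrow> (nat \<Rightarrow> real) \<Rightarrow> (nat \<Rightarrow> real) \<Rightarrow> real \<times> real" where
  "Wmap n lam x = (sqnorm n x, sqnorm_m1 n lam x)"

end

theory Submission
  imports Defs
begin

text \<open>Let \<open>q\<close> be one of the quadratic forms \<open>|x|\<^sup>2\<close>, \<open>|x|\<^sub>-\<^sub>1\<^sup>2\<close>. The fields \<open>B\<close>, \<open>T\<^sub>J\<close>, \<open>R\<^sub>i\<close> are all
  tangent to the level sets of \<open>q\<close>, so the generator applied to \<open>\<phi> \<circ> q\<close> is \<open>\<phi>'(q) D + \<phi>''(q) G\<close> and does not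
  involve \<open>\<epsilon>\<close>. Since \<open>D \<le> A - 2 q\<close> and \<open>0 \<le> G \<le> g q\<close>, stationarity, tested on powers of a truncation of
  \<open>q\<close>, bounds all moments of \<open>q(X\<^sub>t)\<close> uniformly in \<open>\<epsilon>\<close>. Expanding \<open>(q(X\<^sub>t) - q(X\<^sub>s))\<^sup>4\<close> in powers of
  \<open>q(X\<^sub>t)\<close> with coefficients depending on \<open>q(X\<^sub>s)\<close>, the martingale problem bounds its expectation by
  \<open>C (t - s) powr (3/2)\<close>, and Kolmogorov's chaining argument gives tightness.\<close>

section \<open>Equicontinuous families of paths\<close>

definition equicontinuous_on_intervals :: "(real \<Rightarrow> 'a::metric_space) set \<Rightarrow> bool" where
  "equicontinuous_on_intervals K \<longleftrightarrow>
     (\<forall>T. \<forall>e>0. \<exists>d>0. \<forall>w\<in>K. \<forall>s\<in>{0..T}. \<forall>t\<in>{0..T}. dist s t \<le> d \<longrightarrow> dist (w s) (w t) \<le> e)"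

lemma equicontinuous_on_intervalsE:
  assumes "equicontinuous_on_intervals K" "e > 0"
  obtains d where "d > 0"
    "\<And>w s t. w \<in> K \<Longrightarrow> s \<in> {0..T} \<Longrightarrow> t \<in> {0..T} \<Longrightarrow> dist s t \<le> d \<Longrightarrow> dist (w s) (w t) \<le> e"
  using assms unfolding equicontinuous_on_intervals_def by meson

lemma continuous_on_eval [continuous_intros]:
  "continuous_on A (\<lambda>w :: 'i \<Rightarrow> 'a::topological_space. w i)"
  by (rule continuous_on_subset[OF continuous_on_product_coordinates]) simp

lemma equicontinuous_on_intervals_closure:
  assumes "equicontinuous_on_intervals K"
  shows "equicontinuous_on_intervals (closure K)"
  unfolding equicontinuous_on_intervals_def
proof (intro allI impI)
  fix T e :: real assume "e > 0"
  then obtain d where "d > 0" and d: "\<And>w s t. w \<in> K \<Longrightarrow> s \<in> {0..T} \<Longrightarrow> t \<in> {0..T} \<Longrightarrow>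
      dist s t \<le> d \<Longrightarrow> dist (w s) (w t) \<le> e"
    using equicontinuous_on_intervalsE[OF assms] by metis
  have "closure K \<subseteq> {w. dist (w s) (w t) \<le> e}"
    if "s \<in> {0..T}" "t \<in> {0..T}" "dist s t \<le> d" for s t
    using d that by (intro closure_minimal closed_Collect_le continuous_intros) auto
  then show "\<exists>d>0. \<forall>w\<in>closure K. \<forall>s\<in>{0..T}. \<forall>t\<in>{0..T}. dist s t \<le> d \<longrightarrow> dist (w s) (w t) \<le> e"
    using \<open>d > 0\<close> by blast
qed

lemma equicontinuous_on_intervals_imp_continuous:
  assumes K: "equicontinuous_on_intervals K" "w \<in> K" and const: "\<And>t. t \<le> 0 \<Longrightarrow> w t = w 0"
  shows "continuous_on UNIV w"
proof -
  have "continuous_on {0..} w"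
    unfolding continuous_on_iff
  proof (intro ballI allI impI)
    fix x e :: real assume "x \<in> {0..}" "e > 0"
    then obtain d where d: "d > 0" "\<And>s t. s \<in> {0..x + 1} \<Longrightarrow> t \<in> {0..x + 1} \<Longrightarrow>
        dist s t \<le> d \<Longrightarrow> dist (w s) (w t) \<le> e / 2"
      using equicontinuous_on_intervalsE[OF K(1), of "e / 2" "x + 1"] K(2) by (metis half_gt_zero)
    have "dist (w y) (w x) < e" if "y \<in> {0..}" "dist y x < min d 1" for y
    proof -
      have "dist (w y) (w x) \<le> e / 2"
        using that \<open>x \<in> {0..}\<close> by (intro d(2)) (auto simp: dist_real_def)
      then show ?thesis using \<open>e > 0\<close> by simp
    qed
    then show "\<exists>d>0. \<forall>y\<in>{0..}. dist y x < d \<longrightarrow> dist (w y) (w x) < e"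
      using d(1) by (intro exI[of _ "min d 1"]) auto
  qed
  then have "continuous_on UNIV (\<lambda>t. w (max 0 t))"
    by (rule continuous_on_compose2) (auto intro!: continuous_intros)
  moreover have "w (max 0 t) = w t" for t
    using const[of t] by (cases "t \<le> 0") auto
  ultimately show ?thesis by simp
qed

lemma equicontinuous_on_intervals_bounded:
  assumes K: "equicontinuous_on_intervals K" and bounded_0: "bounded ((\<lambda>w. w 0) ` K)" and t: "0 \<le> t"
  shows "bounded ((\<lambda>w. w t) ` K)"
proof -
  obtain d where d: "d > 0" "\<And>w r s. w \<in> K \<Longrightarrow> r \<in> {0..t} \<Longrightarrow> s \<in> {0..t} \<Longrightarrow>
      dist r s \<le> d \<Longrightarrow> dist (w r) (w s) \<le> 1"
    using equicontinuous_on_intervalsE[OF K zero_less_one] by metis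
  obtain N :: nat where N: "t / d \<le> real N" "N > 0"
    using real_arch_simple[of "max 1 (t / d)"] by auto
  have step: "t / real N \<le> d"
    using N d(1) by (simp add: field_simps)
  have chain: "dist (w (real i * (t / real N))) (w 0) \<le> real i" if "w \<in> K" "i \<le> N" for w i
    using that(2)
  proof (induction i)
    case (Suc i)
    have range: "real k * (t / real N) \<in> {0..t}" if "k \<le> N" for k
      using that N(2) t by (auto simp: field_simps intro!: mult_left_mono)
    have "dist (real (Suc i) * (t / real N)) (real i * (t / real N)) \<le> d"
      using step t by (simp add: dist_real_def left_diff_distrib[symmetric] flip: times_divide_eq_right)
    then have "dist (w (real (Suc i) * (t / real N))) (w (real i * (t / real N))) \<le> 1"
      using Suc.prems by (intro d(2)[OF \<open>w \<in> K\<close>] range) simp_all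
    with Suc show ?case
      using dist_triangle[of "w (real (Suc i) * (t / real N))" "w 0" "w (real i * (t / real N))"]
      by simp
  qed simp
  obtain a e where e: "\<And>w. w \<in> K \<Longrightarrow> dist a (w 0) \<le> e"
    using bounded_0 by (auto simp: bounded_def)
  have "dist a (w t) \<le> e + real N" if "w \<in> K" for w
    using e[OF that] chain[OF that order_refl] N(2) dist_triangle[of a "w t" "w 0"]
    by (simp add: dist_commute)
  then show ?thesis by (auto simp: bounded_def)
qed

lemma compact_pointwise_bounded:
  fixes K :: "('i \<Rightarrow> 'a::heine_borel) set"
  assumes "closed K" and "\<And>i. bounded ((\<lambda>w. w i) ` K)"
  shows "compact K"
proof -
  let ?C = "PiE UNIV (\<lambda>i. closure ((\<lambda>w. w i) ` K))"
  have "compactin (product_topology (\<lambda>_. euclidean) UNIV) ?C"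
    using assms(2) by (subst compactin_PiE) auto
  then have "compact ?C" by (simp add: euclidean_product_topology)
  moreover have "K \<subseteq> ?C"
    using closure_subset by fastforce
  ultimately show ?thesis
    using assms(1) by (metis closed_Int_compact inf.absorb1)
qed

text \<open>On an equicontinuous set, finitely many evaluations control the uniform distance on an interval,
  so the compactness that Tychonoff's theorem gives for the product topology carries over to locally
  uniform convergence.\<close>
lemma equicontinuous_on_intervals_nbhd:
  fixes K :: "(real \<Rightarrow> 'a::metric_space) set"
  assumes K: "equicontinuous_on_intervals K" "w \<in> K" and e: "e > 0"
  obtains V where "open V" "w \<in> V"
    "\<And>v t. v \<in> V \<Longrightarrow> v \<in> K \<Longrightarrow> t \<in> {0..T} \<Longrightarrow> dist (v t) (w t) < e"
proof -
  obtain d where d: "d > 0" "\<And>v s t. v \<in> K \<Longrightarrow> s \<in> {0..T} \<Longrightarrow> t \<in> {0..T} \<Longrightarrow>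
      dist s t \<le> d \<Longrightarrow> dist (v s) (v t) \<le> e / 3"
    using equicontinuous_on_intervalsE[OF K(1), of "e / 3" T] e
    by (metis divide_pos_pos zero_less_numeral)
  obtain F where F: "finite F" "F \<subseteq> {0..T}" "{0..T} \<subseteq> (\<Union>s\<in>F. ball s d)"
    using seq_compact_imp_totally_bounded[OF compact_imp_seq_compact[OF compact_Icc[of 0 T]]] d(1)
    by metis
  define V where "V = (\<Inter>s\<in>F. {v. dist (v s) (w s) < e / 3})"
  show thesis
  proof
    show "open V"
      unfolding V_def using F(1) by (intro open_INT ballI open_Collect_less continuous_intros)
    show "w \<in> V" using e by (simp add: V_def)
    fix v t assume v: "v \<in> V" "v \<in> K" and t: "t \<in> {0..T}"
    obtain s where s: "s \<in> F" "dist s t < d" using F(3) t by auto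
    have "dist (v t) (v s) \<le> e / 3" "dist (w s) (w t) \<le> e / 3"
      using d(2)[OF v(2), of t s] d(2)[OF K(2), of s t] s F(2) t by (auto simp: dist_commute)
    moreover have "dist (v s) (w s) < e / 3" using v(1) s(1) by (simp add: V_def)
    moreover have "dist (v t) (w t) \<le> dist (v t) (v s) + dist (v s) (w s) + dist (w s) (w t)"
      by (metis add_right_mono dist_triangle order_trans)
    ultimately show "dist (v t) (w t) < e" by linarith
  qed
qed

lemma CPaths_dist_less_uniform:
  assumes "w \<in> CPaths S" "u \<in> CPaths S'" "0 \<le> T" and less: "\<And>t. t \<in> {0..T} \<Longrightarrow> dist (w t) (u t) < r"
  obtains \<rho> where "\<rho> < r" "\<And>t. t \<in> {0..T} \<Longrightarrow> dist (w t) (u t) \<le> \<rho>"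
proof -
  have "continuous_on {0..T} (\<lambda>t. dist (w t) (u t))"
    using assms(1,2) unfolding CPaths_def
    by (intro continuous_intros) (auto intro: continuous_on_subset)
  then have "\<exists>x\<in>{0..T}. \<forall>y\<in>{0..T}. dist (w y) (u y) \<le> dist (w x) (u x)"
    using assms(3) by (intro continuous_attains_sup) auto
  then show ?thesis using that less by blast
qed

lemma continuous_map_luc_topology:
  assumes K: "K \<subseteq> CPaths S" "equicontinuous_on_intervals K"
  shows "continuous_map (top_of_set K) (luc_topology (CPaths S)) id"
  unfolding luc_topology_def
proof (rule continuous_on_generated_topo)
  let ?U = "\<lambda>u T r. {v \<in> CPaths S. \<forall>t\<in>{0..T}. dist (v t) (u t) < r}"
  show "id ` topspace (top_of_set K) \<subseteq> \<Union> {?U u T r | u T r. u \<in> CPaths S \<and> T > 0 \<and> r > 0}"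
  proof
    fix w assume "w \<in> id ` topspace (top_of_set K)"
    then have "w \<in> CPaths S" using K(1) by auto
    then have "w \<in> ?U w 1 1" by simp
    with \<open>w \<in> CPaths S\<close> show "w \<in> \<Union> {?U u T r | u T r. u \<in> CPaths S \<and> T > 0 \<and> r > 0}"
      using zero_less_one by blast
  qed
  fix U assume "U \<in> {?U u T r | u T r. u \<in> CPaths S \<and> T > 0 \<and> r > 0}"
  then obtain u T r where U: "U = ?U u T r" and u: "u \<in> CPaths S" "T > 0" by blast
  show "openin (top_of_set K) (id -` U \<inter> topspace (top_of_set K))"
  proof (subst openin_subopen, intro ballI)
    fix w assume "w \<in> id -` U \<inter> topspace (top_of_set K)"
    then have w: "w \<in> K" "w \<in> U" by auto
    then obtain \<rho> where \<rho>: "\<rho> < r" "\<And>t. t \<in> {0..T} \<Longrightarrow> dist (w t) (u t) \<le> \<rho>"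
      using u(2) unfolding U by (auto intro: CPaths_dist_less_uniform[OF _ u(1), of w S T r])
    have "0 < r - \<rho>" using \<rho>(1) by simp
    from equicontinuous_on_intervals_nbhd[OF K(2) w(1) this, of T]
    obtain V where V: "open V" "w \<in> V"
      "\<And>v t. v \<in> V \<Longrightarrow> v \<in> K \<Longrightarrow> t \<in> {0..T} \<Longrightarrow> dist (v t) (w t) < r - \<rho>" by blast
    have "dist (v t) (u t) < r" if "v \<in> V \<inter> K" "t \<in> {0..T}" for v t
      using V(3)[of v t] \<rho>(2)[of t] dist_triangle[of "v t" "u t" "w t"] that by simp
    then have "V \<inter> K \<subseteq> U" using K(1) unfolding U by blast
    moreover have "openin (top_of_set K) (V \<inter> K)"
      using V(1) by (metis inf_commute openin_open_Int)
    ultimately show "\<exists>W. openin (top_of_set K) W \<and> w \<in> W \<and> W \<subseteq> id -` U \<inter> topspace (top_of_set K)"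
      using V(2) w(1) \<open>V \<inter> K \<subseteq> U\<close> by (intro exI[of _ "V \<inter> K"]) auto
  qed
qed

lemma closed_CPaths_Int:
  assumes "closed S" "closed C" and equicont: "equicontinuous_on_intervals (CPaths S \<inter> C)"
  shows "closed (CPaths S \<inter> C)"
proof -
  let ?K = "CPaths S \<inter> C"
  have "w \<in> ?K" if w: "w \<in> closure ?K" for w
  proof -
    have "closure ?K \<subseteq> C" using assms(2) by (intro closure_minimal) auto
    moreover have "closure ?K \<subseteq> {w. w t \<in> S}" for t
      using closed_vimage[OF assms(1) continuous_on_eval]
      by (intro closure_minimal) (auto simp: CPaths_def vimage_def)
    moreover have const: "closure ?K \<subseteq> {w. w t = w 0}" if "t \<le> 0" for t
      using that by (intro closure_minimal closed_Collect_eq continuous_intros) (auto simp: CPaths_def)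
    moreover have "continuous_on UNIV w"
      using equicontinuous_on_intervals_imp_continuous[OF equicontinuous_on_intervals_closure[OF equicont] w]
        const w by blast
    ultimately show ?thesis using w unfolding CPaths_def by blast
  qed
  then show ?thesis by (simp add: closure_subset_eq[symmetric] subsetI)
qed

theorem Arzela_Ascoli_luc_topology:
  assumes S: "closed S" and C: "closed C" and equicont: "equicontinuous_on_intervals (CPaths S \<inter> C)"
    and bounded: "bounded ((\<lambda>w. w 0) ` (CPaths S \<inter> C))"
  shows "compactin (luc_topology (CPaths S)) (CPaths S \<inter> C)"
proof -
  let ?K = "CPaths S \<inter> C"
  have "bounded ((\<lambda>w. w t) ` ?K)" for t
  proof (cases "0 \<le> t")
    case True
    then show ?thesis by (rule equicontinuous_on_intervals_bounded[OF equicont bounded])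
  next
    case False
    then have "t \<le> 0" by simp
    then have "w t = w 0" if "w \<in> ?K" for w
      using that unfolding CPaths_def by blast
    then have "(\<lambda>w. w t) ` ?K = (\<lambda>w. w 0) ` ?K"
      by (rule image_cong[OF refl])
    then show ?thesis using bounded by simp
  qed
  then have "compactin (top_of_set ?K) ?K"
    using compact_pointwise_bounded[OF closed_CPaths_Int[OF S C equicont]]
    by (simp add: compactin_subtopology)
  then have "compactin (luc_topology (CPaths S)) (id ` ?K)"
    by (rule image_compactin) (intro continuous_map_luc_topology equicont Int_lower1)
  then show ?thesis by simp
qed

section \<open>A Kolmogorov tightness criterion\<close>

definition dyadic_index :: "nat \<Rightarrow> real \<Rightarrow> nat" where
  "dyadic_index k t = nat \<lfloor>2^k * t\<rfloor>"

definition dyadic_increments_le :: "real \<Rightarrow> nat \<Rightarrow> (real \<Rightarrow> 'a::metric_space) \<Rightarrow> bool" where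
  "dyadic_increments_le \<gamma> k0 w \<longleftrightarrow>
     (\<forall>k\<ge>k0. \<forall>j\<le>k * 2^k. dist (w (real (Suc j) / 2^k)) (w (real j / 2^k)) \<le> \<gamma>^k)"

lemma dyadic_index_bounds:
  assumes "0 \<le> t"
  shows "real (dyadic_index k t) \<le> 2^k * t" "2^k * t < real (dyadic_index k t) + 1"
proof -
  have "0 \<le> \<lfloor>2^k * t\<rfloor>" using assms by simp
  then have "real (dyadic_index k t) = real_of_int \<lfloor>2^k * t\<rfloor>" by (simp add: dyadic_index_def)
  then show "real (dyadic_index k t) \<le> 2^k * t" "2^k * t < real (dyadic_index k t) + 1" by linarith+
qed

lemma dyadic_index_le:
  assumes "0 \<le> t" "t \<le> real m" "m \<le> k"
  shows "dyadic_index k t \<le> k * 2^k"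
proof -
  have "real (dyadic_index k t) \<le> 2^k * t" by (rule dyadic_index_bounds(1)[OF assms(1)])
  also have "\<dots> \<le> 2^k * real k" using assms by (intro mult_left_mono) auto
  finally have "real (dyadic_index k t) \<le> real (k * 2^k)" by (simp add: mult.commute)
  then show ?thesis by (simp only: of_nat_le_iff)
qed

lemma dyadic_index_Suc:
  assumes "0 \<le> t"
  shows "dyadic_index (Suc k) t = 2 * dyadic_index k t
      \<or> dyadic_index (Suc k) t = Suc (2 * dyadic_index k t)"
proof -
  have "real (dyadic_index (Suc k) t) < real (2 * dyadic_index k t + 2)"
    "real (2 * dyadic_index k t) < real (dyadic_index (Suc k) t + 1)"
    using dyadic_index_bounds[OF assms, of k] dyadic_index_bounds[OF assms, of "Suc k"]
    by (simp_all add: mult.assoc)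
  then show ?thesis by (simp only: of_nat_less_iff) arith
qed

lemma dyadic_approx_tendsto:
  assumes "0 \<le> t"
  shows "(\<lambda>k. real (dyadic_index k t) / 2^k) \<longlonglongrightarrow> t"
proof (rule real_tendsto_sandwich)
  show "\<forall>\<^sub>F k in sequentially. t - (1/2)^k \<le> real (dyadic_index k t) / 2^k"
  proof (intro always_eventually allI)
    fix k
    have "t \<le> (real (dyadic_index k t) + 1) / 2^k"
      using dyadic_index_bounds(2)[OF assms, of k] by (simp add: pos_le_divide_eq mult.commute)
    then show "t - (1/2)^k \<le> real (dyadic_index k t) / 2^k"
      by (simp add: add_divide_distrib power_one_over)
  qed
  show "\<forall>\<^sub>F k in sequentially. real (dyadic_index k t) / 2^k \<le> t"
    using dyadic_index_bounds(1)[OF assms]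
    by (intro always_eventually allI) (simp add: pos_divide_le_eq mult.commute)
  have "(\<lambda>k. t - (1/2)^k) \<longlonglongrightarrow> t - 0"
    by (intro tendsto_intros LIMSEQ_power_zero) simp
  then show "(\<lambda>k. t - (1/2)^k) \<longlonglongrightarrow> t" by simp
qed simp

lemma dyadic_refinement_dist_le:
  assumes w: "dyadic_increments_le \<gamma> k0 w" and \<gamma>: "0 \<le> \<gamma>" and k: "k0 \<le> k" "0 \<le> t" "t \<le> real k"
  shows "dist (w (real (dyadic_index (Suc k) t) / 2^Suc k)) (w (real (dyadic_index k t) / 2^k)) \<le> \<gamma>^Suc k"
proof -
  have same: "real (dyadic_index k t) / 2^k = real (2 * dyadic_index k t) / 2^Suc k" by simp
  consider (left) "dyadic_index (Suc k) t = 2 * dyadic_index k t"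
    | (right) "dyadic_index (Suc k) t = Suc (2 * dyadic_index k t)"
    using dyadic_index_Suc[OF k(2)] by blast
  then show ?thesis
  proof cases
    case left
    then show ?thesis unfolding same using \<gamma> by simp
  next
    case right
    have "2 * dyadic_index k t \<le> Suc k * 2^Suc k"
      using dyadic_index_le[OF k(2,3) order_refl] by simp
    moreover have "k0 \<le> Suc k" using k(1) by simp
    ultimately show ?thesis
      unfolding same right using w unfolding dyadic_increments_le_def by blast
  qed
qed

lemma dyadic_approx_dist_le:
  fixes w :: "real \<Rightarrow> 'a::metric_space"
  assumes cont: "continuous_on UNIV w" and w: "dyadic_increments_le \<gamma> k0 w" and \<gamma>: "0 \<le> \<gamma>" "\<gamma> < 1"
    and m: "k0 \<le> m" "0 \<le> t" "t \<le> real m"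
  shows "dist (w t) (w (real (dyadic_index m t) / 2^m)) \<le> \<gamma>^Suc m / (1 - \<gamma>)"
proof -
  define d where "d = (\<lambda>k. real (dyadic_index k t) / 2^k)"
  have telescope: "dist (w (d (m + i))) (w (d m)) \<le> (\<gamma>^Suc m - \<gamma>^Suc (m + i)) / (1 - \<gamma>)" for i
  proof (induction i)
    case (Suc i)
    have "dist (w (d (m + Suc i))) (w (d m))
        \<le> dist (w (d (Suc (m + i)))) (w (d (m + i))) + dist (w (d (m + i))) (w (d m))"
      using dist_triangle by simp
    also have "\<dots> \<le> \<gamma>^Suc (m + i) + (\<gamma>^Suc m - \<gamma>^Suc (m + i)) / (1 - \<gamma>)"
      unfolding d_def using m Suc[unfolded d_def]
      by (intro add_mono dyadic_refinement_dist_le[OF w \<gamma>(1)]) auto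
    also have "\<dots> = (\<gamma>^Suc m - \<gamma>^Suc (m + Suc i)) / (1 - \<gamma>)"
      using \<gamma>(2) by (simp add: field_simps)
    finally show ?case .
  qed simp
  have "(\<lambda>i. d (m + i)) \<longlonglongrightarrow> t"
    using LIMSEQ_ignore_initial_segment[OF dyadic_approx_tendsto[OF m(2)], of m]
    by (simp add: d_def add.commute)
  moreover have "isCont w t" using cont by (simp add: continuous_on_eq_continuous_at)
  ultimately have "(\<lambda>i. dist (w (d (m + i))) (w (d m))) \<longlonglongrightarrow> dist (w t) (w (d m))"
    by (intro tendsto_dist tendsto_const isCont_tendsto_compose[of t w])
  moreover have "dist (w (d (m + i))) (w (d m)) \<le> \<gamma>^Suc m / (1 - \<gamma>)" for i
    using \<gamma> by (intro order_trans[OF telescope] divide_right_mono) auto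
  ultimately show ?thesis
    unfolding d_def by (intro LIMSEQ_le_const2) auto
qed

lemma dyadic_increments_modulus:
  fixes w :: "real \<Rightarrow> 'a::metric_space"
  assumes cont: "continuous_on UNIV w" and w: "dyadic_increments_le \<gamma> k0 w" and \<gamma>: "0 \<le> \<gamma>" "\<gamma> < 1"
    and m: "k0 \<le> m" and s: "s \<in> {0..real m}" and t: "t \<in> {0..real m}" and st: "dist s t \<le> 1 / 2^m"
  shows "dist (w s) (w t) \<le> (1 + \<gamma>) / (1 - \<gamma>) * \<gamma>^m"
  using s t st
proof (induction s t rule: linorder_wlog)
  case (le s t)
  let ?i = "dyadic_index m s" and ?j = "dyadic_index m t"
  have "2^m * s \<le> 2^m * t" "2^m * t \<le> 2^m * s + 1"
    using le by (auto simp: dist_real_def field_simps)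
  moreover have "0 \<le> s" "0 \<le> t" using le by auto
  ultimately have "real ?i < real (?j + 1)" "real ?j < real (?i + 2)"
    using dyadic_index_bounds[of s m] dyadic_index_bounds[of t m]
    unfolding of_nat_add of_nat_1 of_nat_numeral by linarith+
  then have "?j = ?i \<or> ?j = Suc ?i" by (simp only: of_nat_less_iff) arith
  moreover have "?i \<le> m * 2^m"
    by (rule dyadic_index_le[of s m m]) (use le in auto)
  then have "dist (w (real (Suc ?i) / 2^m)) (w (real ?i / 2^m)) \<le> \<gamma>^m"
    using w m unfolding dyadic_increments_le_def by blast
  ultimately have grid: "dist (w (real ?j / 2^m)) (w (real ?i / 2^m)) \<le> \<gamma>^m"
    using \<gamma> by auto
  have approx: "dist (w s) (w (real ?i / 2^m)) \<le> \<gamma>^Suc m / (1 - \<gamma>)"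
    "dist (w t) (w (real ?j / 2^m)) \<le> \<gamma>^Suc m / (1 - \<gamma>)"
    using dyadic_approx_dist_le[OF cont w \<gamma> m] le by auto
  have "dist (w s) (w t) \<le> dist (w s) (w (real ?i / 2^m))
      + (dist (w (real ?j / 2^m)) (w (real ?i / 2^m)) + dist (w t) (w (real ?j / 2^m)))"
    using dist_triangle[of "w s" "w t" "w (real ?i / 2^m)"]
      dist_triangle2[of "w (real ?i / 2^m)" "w t" "w (real ?j / 2^m)"] by (simp add: dist_commute)
  also have "\<dots> \<le> \<gamma>^Suc m / (1 - \<gamma>) + (\<gamma>^m + \<gamma>^Suc m / (1 - \<gamma>))"
    by (intro add_mono grid approx)
  also have "\<dots> = (1 + \<gamma>) / (1 - \<gamma>) * \<gamma>^m"
    using \<gamma>(2) by (simp add: divide_simps) (simp add: algebra_simps)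
  finally show ?case .
next
  case (sym s t)
  then show ?case by (simp add: dist_commute)
qed

lemma equicontinuous_dyadic_increments:
  fixes K :: "(real \<Rightarrow> 'a::metric_space) set"
  assumes \<gamma>: "0 \<le> \<gamma>" "\<gamma> < 1"
    and K: "\<And>w. w \<in> K \<Longrightarrow> continuous_on UNIV w \<and> dyadic_increments_le \<gamma> k0 w"
  shows "equicontinuous_on_intervals K"
  unfolding equicontinuous_on_intervals_def
proof (intro allI impI)
  fix T e :: real assume "e > 0"
  have "(\<lambda>m. (1 + \<gamma>) / (1 - \<gamma>) * \<gamma>^m) \<longlonglongrightarrow> (1 + \<gamma>) / (1 - \<gamma>) * 0"
    using \<gamma> by (intro tendsto_intros LIMSEQ_power_zero) simp
  then have "\<forall>\<^sub>F m in sequentially. (1 + \<gamma>) / (1 - \<gamma>) * \<gamma>^m < e"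
    using \<open>e > 0\<close> by (intro order_tendstoD(2)) auto
  moreover have "\<forall>\<^sub>F m in sequentially. T \<le> real m"
    using filterlim_real_sequentially by (simp add: filterlim_at_top)
  moreover have "\<forall>\<^sub>F m in sequentially. k0 \<le> m" by (rule eventually_ge_at_top)
  ultimately have "\<forall>\<^sub>F m in sequentially. (1 + \<gamma>) / (1 - \<gamma>) * \<gamma>^m < e \<and> T \<le> real m \<and> k0 \<le> m"
    by eventually_elim simp
  then obtain m where m: "(1 + \<gamma>) / (1 - \<gamma>) * \<gamma>^m < e" "T \<le> real m" "k0 \<le> m"
    by (auto simp: eventually_sequentially)
  have "dist (w s) (w t) \<le> e"
    if "w \<in> K" "s \<in> {0..T}" "t \<in> {0..T}" "dist s t \<le> 1 / 2^m" for w s t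
    using dyadic_increments_modulus[OF _ _ \<gamma> m(3), of w s t] K[OF that(1)] that(2-4) m(1,2) by auto
  then show "\<exists>d>0. \<forall>w\<in>K. \<forall>s\<in>{0..T}. \<forall>t\<in>{0..T}. dist s t \<le> d \<longrightarrow> dist (w s) (w t) \<le> e"
    by (intro exI[of _ "1 / 2^m"]) auto
qed

text \<open>Membership of a path in this set depends on countably many times only, which makes it an event for
  every continuous process.\<close>
lemma compactin_luc_dyadic_increments:
  assumes S: "closed S" and \<gamma>: "0 \<le> \<gamma>" "\<gamma> < 1"
  shows "compactin (luc_topology (CPaths S))
    (CPaths S \<inter> {w. norm (w 0) \<le> B \<and> dyadic_increments_le \<gamma> k0 w})" (is "compactin _ (_ \<inter> ?C)")
proof (rule Arzela_Ascoli_luc_topology[OF S])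
  show "closed ?C"
    unfolding dyadic_increments_le_def
    by (intro closed_Collect_conj closed_Collect_all closed_Collect_imp open_Collect_const
        closed_Collect_le continuous_intros)
  show "equicontinuous_on_intervals (CPaths S \<inter> ?C)"
    by (rule equicontinuous_dyadic_increments[OF \<gamma>]) (auto simp: CPaths_def)
  show "bounded ((\<lambda>w. w 0) ` (CPaths S \<inter> ?C))"
    unfolding bounded_iff by auto
qed

text \<open>Any ratio \<open>\<gamma> < 1\<close> with \<open>\<gamma> powr p > 2 powr (- \<beta>)\<close> would do.\<close>
definition chaining_ratio :: "real \<Rightarrow> real \<Rightarrow> real" where
  "chaining_ratio p \<beta> = 2 powr (- \<beta> / (2 * p))"

lemma chaining_ratio_bounds:
  assumes "p > 0" "\<beta> > 0"
  shows "0 < chaining_ratio p \<beta>" "chaining_ratio p \<beta> < 1"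
  using assms powr_less_mono[of "- \<beta> / (2 * p)" 0 "2::real"] by (simp_all add: chaining_ratio_def)

lemma summable_chaining_bound:
  assumes "\<beta> > 0"
  shows "summable (\<lambda>k. C * real (Suc k) * (2 powr (- \<beta> / 2))^k)"
proof -
  have "norm (2 powr (- \<beta> / 2) :: real) < 1"
    using assms powr_less_mono[of "- \<beta> / 2" 0 "2::real"] by simp
  from sums_summable[OF geometric_deriv_sums[OF this]]
  have "summable (\<lambda>k. real (Suc k) * (2 powr (- \<beta> / 2))^k)" .
  then show ?thesis unfolding mult.assoc by (rule summable_mult)
qed

locale Kolmogorov_increments = prob_space M
  for M :: "'a measure" +
  fixes X :: "real \<Rightarrow> 'a \<Rightarrow> 'b::{metric_space, second_countable_topology}" and p \<beta> C :: real
  assumes p: "p > 0" and \<beta>: "\<beta> > 0"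
    and measurable_X: "t \<ge> 0 \<Longrightarrow> X t \<in> borel_measurable M"
    and integrable_dist: "0 \<le> s \<Longrightarrow> s < t \<Longrightarrow> integrable M (\<lambda>\<omega>. dist (X t \<omega>) (X s \<omega>) powr p)"
    and expectation_dist_le: "0 \<le> s \<Longrightarrow> s < t \<Longrightarrow>
      expectation (\<lambda>\<omega>. dist (X t \<omega>) (X s \<omega>) powr p) \<le> C * (t - s) powr (1 + \<beta>)"
begin

lemma C_nonneg: "0 \<le> C"
proof -
  have "0 \<le> expectation (\<lambda>\<omega>. dist (X 1 \<omega>) (X 0 \<omega>) powr p)" by simp
  also have "\<dots> \<le> C" using expectation_dist_le[of 0 1] by simp
  finally show ?thesis .
qed

lemma measurable_dyadic [measurable]: "X (real j / 2^k) \<in> borel_measurable M"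
  by (rule measurable_X) simp

lemma prob_dyadic_increment_gt_le:
  "prob {\<omega> \<in> space M. dist (X (real (Suc j) / 2^k) \<omega>) (X (real j / 2^k) \<omega>) > chaining_ratio p \<beta>^k}
    \<le> C * ((1/2)^k * (2 powr (- \<beta> / 2))^k)"
proof -
  let ?\<gamma> = "chaining_ratio p \<beta>"
  let ?d = "\<lambda>\<omega>. dist (X (real (Suc j) / 2^k) \<omega>) (X (real j / 2^k) \<omega>)"
  have times: "0 \<le> real j / 2^k" "real j / 2^k < real (Suc j) / 2^k"
    by (auto simp: divide_strict_right_mono)
  have "(?\<gamma>^k) powr p \<le> x powr p" if "x > ?\<gamma>^k" for x
    using p that by (intro powr_mono2) (auto simp: chaining_ratio_def)
  then have "prob {\<omega> \<in> space M. ?d \<omega> > ?\<gamma>^k} \<le> prob {\<omega> \<in> space M. ?d \<omega> powr p \<ge> (?\<gamma>^k) powr p}"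
    by (intro finite_measure_mono subsetI) (simp_all del: of_nat_Suc)
  also have "\<dots> \<le> expectation (\<lambda>\<omega>. ?d \<omega> powr p) / (?\<gamma>^k) powr p"
    by (rule integral_Markov_inequality_measure[where A = "{}"])
       (use integrable_dist[OF times] in \<open>auto simp: chaining_ratio_def\<close>)
  also have "\<dots> \<le> C * (real (Suc j) / 2^k - real j / 2^k) powr (1 + \<beta>) / (?\<gamma>^k) powr p"
    by (intro divide_right_mono expectation_dist_le times) simp
  also have "real (Suc j) / 2^k - real j / 2^k = 2 powr (- real k)"
    by (simp add: powr_minus powr_realpow field_simps)
  also have "(?\<gamma>^k) powr p = 2 powr (- \<beta> * real k / 2)"
    using p by (simp add: chaining_ratio_def powr_realpow[symmetric] powr_powr)
  also have "C * (2 powr (- real k)) powr (1 + \<beta>) / 2 powr (- \<beta> * real k / 2)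
      = C * 2 powr (- real k * (1 + \<beta>) - - \<beta> * real k / 2)"
    by (simp only: powr_powr powr_diff times_divide_eq_right)
  also have "- real k * (1 + \<beta>) - - \<beta> * real k / 2 = - real k + - \<beta> / 2 * real k"
    by (simp add: field_simps)
  also have "2 powr (- real k + - \<beta> / 2 * real k) = (1/2)^k * (2 powr (- \<beta> / 2))^k"
    unfolding powr_add powr_powr[symmetric]
    by (simp add: powr_minus powr_realpow power_one_over inverse_eq_divide)
  finally show ?thesis .
qed

lemma prob_dyadic_level_le:
  "prob {\<omega> \<in> space M. \<exists>j\<le>k * 2^k.
      dist (X (real (Suc j) / 2^k) \<omega>) (X (real j / 2^k) \<omega>) > chaining_ratio p \<beta>^k}
    \<le> C * real (Suc k) * (2 powr (- \<beta> / 2))^k"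
proof -
  define E where "E = (\<lambda>j. {\<omega> \<in> space M.
    dist (X (real (Suc j) / 2^k) \<omega>) (X (real j / 2^k) \<omega>) > chaining_ratio p \<beta>^k})"
  have [measurable]: "E j \<in> events" for j unfolding E_def by measurable
  have "{\<omega> \<in> space M. \<exists>j\<le>k * 2^k.
      dist (X (real (Suc j) / 2^k) \<omega>) (X (real j / 2^k) \<omega>) > chaining_ratio p \<beta>^k}
    = (\<Union>j\<in>{..k * 2^k}. E j)"
    by (auto simp: E_def)
  also have "prob \<dots> \<le> (\<Sum>j\<in>{..k * 2^k}. prob (E j))"
    by (intro finite_measure_subadditive_finite) auto
  also have "\<dots> \<le> (\<Sum>j\<in>{..k * 2^k}. C * ((1/2)^k * (2 powr (- \<beta> / 2))^k))"
    unfolding E_def by (intro sum_mono prob_dyadic_increment_gt_le)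
  also have "\<dots> = real (k * 2^k + 1) * (C * ((1/2)^k * (2 powr (- \<beta> / 2))^k))" by simp
  also have "\<dots> \<le> real (Suc k * 2^k) * (C * ((1/2)^k * (2 powr (- \<beta> / 2))^k))"
    using C_nonneg by (intro mult_right_mono) (simp_all only: of_nat_le_iff, auto)
  also have "\<dots> = C * real (Suc k) * (2 powr (- \<beta> / 2))^k"
    by (simp add: power_one_over field_simps)
  finally show ?thesis .
qed

lemma prob_not_dyadic_increments_le:
  "prob {\<omega> \<in> space M. \<not> dyadic_increments_le (chaining_ratio p \<beta>) k0 (\<lambda>t. X t \<omega>)}
    \<le> (\<Sum>k. C * real (Suc (k + k0)) * (2 powr (- \<beta> / 2))^(k + k0))"
proof -
  define b where "b = (\<lambda>k. C * real (Suc k) * (2 powr (- \<beta> / 2))^k)"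
  define F where "F = (\<lambda>k. {\<omega> \<in> space M. \<exists>j\<le>k * 2^k.
    dist (X (real (Suc j) / 2^k) \<omega>) (X (real j / 2^k) \<omega>) > chaining_ratio p \<beta>^k})"
  have F_sets: "F k \<in> events" for k unfolding F_def by measurable
  have F_le: "prob (F k) \<le> b k" for k
    unfolding F_def b_def by (rule prob_dyadic_level_le)
  have sum_b: "summable (\<lambda>k. b (k + k0))"
    using summable_chaining_bound[OF \<beta>, of C] unfolding b_def by (subst summable_iff_shift)
  then have sum_F: "summable (\<lambda>k. prob (F (k + k0)))"
    by (rule summable_comparison_test') (simp add: F_le)
  have "{\<omega> \<in> space M. \<not> dyadic_increments_le (chaining_ratio p \<beta>) k0 (\<lambda>t. X t \<omega>)} = (\<Union>k\<in>{k0..}. F k)"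
    unfolding dyadic_increments_le_def F_def by (auto simp: not_le)
  also have "{k0..} = range (\<lambda>k. k + k0)"
    by (auto simp: image_iff le_iff_add add.commute)
  also have "prob (\<Union>k\<in>range (\<lambda>k. k + k0). F k) \<le> (\<Sum>k. prob (F (k + k0)))"
    unfolding image_image using finite_measure_subadditive_countably[OF _ sum_F] F_sets by auto
  also have "\<dots> \<le> (\<Sum>k. b (k + k0))"
    by (intro suminf_le F_le sum_F sum_b)
  finally show ?thesis by (simp add: b_def)
qed

end

theorem Kolmogorov_tightness:
  fixes P :: "'i \<Rightarrow> 'a measure" and X :: "'i \<Rightarrow> real \<Rightarrow> 'a \<Rightarrow> real \<times> real"
  assumes S: "closed S" and p: "p > 0" and \<beta>: "\<beta> > 0"
    and path: "\<And>i \<omega>. i \<in> I \<Longrightarrow> \<omega> \<in> space (P i) \<Longrightarrow> (\<lambda>t. X i t \<omega>) \<in> CPaths S"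
    and initial: "\<And>\<eta>. \<eta> > 0 \<Longrightarrow> \<exists>B. \<forall>i\<in>I. measure (P i) {\<omega> \<in> space (P i). norm (X i 0 \<omega>) > B} \<le> \<eta>"
    and increments: "\<And>i. i \<in> I \<Longrightarrow> Kolmogorov_increments (P i) (X i) p \<beta> C"
    and \<eta>: "\<eta> > 0"
  shows "\<exists>K. K \<subseteq> CPaths S \<and> compactin (luc_topology (CPaths S)) K \<and>
    (\<forall>i\<in>I. measure (P i) {\<omega> \<in> space (P i). (\<lambda>t. X i t \<omega>) \<in> K} \<ge> 1 - \<eta>)"
proof -
  let ?\<gamma> = "chaining_ratio p \<beta>"
  note \<gamma> = less_imp_le[OF chaining_ratio_bounds(1)[OF p \<beta>]] chaining_ratio_bounds(2)[OF p \<beta>]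
  obtain B where B: "\<And>i. i \<in> I \<Longrightarrow> measure (P i) {\<omega> \<in> space (P i). norm (X i 0 \<omega>) > B} \<le> \<eta> / 2"
    using initial[of "\<eta> / 2"] \<eta> by auto
  define b where "b = (\<lambda>k. C * real (Suc k) * (2 powr (- \<beta> / 2))^k)"
  obtain k0 where "norm (\<Sum>k. b (k + k0)) < \<eta> / 2"
    using suminf_exist_split[OF half_gt_zero[OF \<eta>] summable_chaining_bound[OF \<beta>, of C]]
    unfolding b_def by blast
  then have k0: "(\<Sum>k. b (k + k0)) < \<eta> / 2" by simp
  let ?C = "{w. norm (w 0) \<le> B \<and> dyadic_increments_le ?\<gamma> k0 w}"
  have "measure (P i) {\<omega> \<in> space (P i). (\<lambda>t. X i t \<omega>) \<in> CPaths S \<inter> ?C} \<ge> 1 - \<eta>" if i: "i \<in> I" for i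
  proof -
    interpret Kolmogorov_increments "P i" "X i" p \<beta> C by (rule increments[OF i])
    have [measurable]: "X i 0 \<in> borel_measurable (P i)" by (rule measurable_X) simp
    define far_start where "far_start = {\<omega> \<in> space (P i). norm (X i 0 \<omega>) > B}"
    define rough where "rough = {\<omega> \<in> space (P i). \<not> dyadic_increments_le ?\<gamma> k0 (\<lambda>t. X i t \<omega>)}"
    have sets [measurable]: "far_start \<in> events" "rough \<in> events"
      unfolding far_start_def rough_def dyadic_increments_le_def by measurable
    have "prob far_start \<le> \<eta> / 2" unfolding far_start_def by (rule B[OF i])
    moreover have "prob rough \<le> (\<Sum>k. b (k + k0))"
      unfolding rough_def b_def by (rule prob_not_dyadic_increments_le)
    ultimately have "prob (far_start \<union> rough) \<le> \<eta>"
      using measure_Un_le[OF sets] k0 by linarith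
    moreover have "{\<omega> \<in> space (P i). (\<lambda>t. X i t \<omega>) \<in> CPaths S \<inter> ?C} = space (P i) - (far_start \<union> rough)"
      using path[OF i] by (auto simp: far_start_def rough_def)
    ultimately show ?thesis by (simp add: prob_compl)
  qed
  then show ?thesis
    using compactin_luc_dyadic_increments[OF S \<gamma>] by (intro exI[of _ "CPaths S \<inter> ?C"]) auto
qed

section \<open>Solutions of martingale problems\<close>

lemma borel_measurable_continuous_process:
  fixes h :: "real \<Rightarrow> 'a \<Rightarrow> 'b::metric_space"
  assumes cont: "\<And>\<omega>. \<omega> \<in> space M \<Longrightarrow> continuous_on UNIV (\<lambda>r. h r \<omega>)"
    and meas: "\<And>r. h r \<in> borel_measurable M"
  shows "(\<lambda>(r, \<omega>). h r \<omega>) \<in> borel_measurable (borel \<Otimes>\<^sub>M M)"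
proof (rule borel_measurable_LIMSEQ_metric)
  let ?g = "\<lambda>k z. h (real_of_int \<lfloor>real (Suc k) * fst z\<rfloor> / real (Suc k)) (snd z)"
  show "?g k \<in> borel_measurable (borel \<Otimes>\<^sub>M M)" for k
  proof (rule measurable_compose_countable[where f = "\<lambda>i z. h (real_of_int i / real (Suc k)) (snd z)"])
    show "(\<lambda>z. h (real_of_int i / real (Suc k)) (snd z)) \<in> borel_measurable (borel \<Otimes>\<^sub>M M)" for i
      by (rule measurable_compose[OF measurable_snd meas])
  qed measurable
  fix z :: "real \<times> 'a" assume "z \<in> space (borel \<Otimes>\<^sub>M M)"
  then obtain r \<omega> where z: "z = (r, \<omega>)" "\<omega> \<in> space M" by (auto simp: space_pair_measure)
  have "(\<lambda>k. real_of_int \<lfloor>real (Suc k) * r\<rfloor> / real (Suc k)) \<longlonglongrightarrow> r"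
  proof (rule real_tendsto_sandwich)
    have "(\<lambda>k. r - 1 / real (Suc k)) \<longlonglongrightarrow> r - 0"
      by (intro tendsto_intros LIMSEQ_Suc[OF lim_const_over_n])
    then show "(\<lambda>k. r - 1 / real (Suc k)) \<longlonglongrightarrow> r" by simp
    have floor: "r * real (Suc k) - 1 \<le> real_of_int \<lfloor>real (Suc k) * r\<rfloor>"
      "real_of_int \<lfloor>real (Suc k) * r\<rfloor> \<le> r * real (Suc k)" for k
      unfolding mult.commute[of r] by linarith+
    show "\<forall>\<^sub>F k in sequentially. r - 1 / real (Suc k) \<le> real_of_int \<lfloor>real (Suc k) * r\<rfloor> / real (Suc k)"
      using floor(1)
      by (intro always_eventually allI) (simp add: le_divide_eq left_diff_distrib del: of_nat_Suc)
    show "\<forall>\<^sub>F k in sequentially. real_of_int \<lfloor>real (Suc k) * r\<rfloor> / real (Suc k) \<le> r"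
      using floor(2) by (intro always_eventually allI) (simp add: divide_le_eq del: of_nat_Suc)
  qed simp
  moreover have "isCont (\<lambda>r. h r \<omega>) r"
    using cont[OF z(2)] by (simp add: continuous_on_eq_continuous_at)
  ultimately show "(\<lambda>k. ?g k z) \<longlonglongrightarrow> (case z of (r, \<omega>) \<Rightarrow> h r \<omega>)"
    by (auto simp: z(1) intro: isCont_tendsto_compose)
qed

lemma (in finite_measure) Fubini_continuous_process:
  fixes h :: "real \<Rightarrow> 'a \<Rightarrow> real"
  assumes cont: "\<And>\<omega>. \<omega> \<in> space M \<Longrightarrow> continuous_on UNIV (\<lambda>r. h r \<omega>)"
    and meas: "\<And>r. h r \<in> borel_measurable M"
    and bdd: "\<And>r \<omega>. \<omega> \<in> space M \<Longrightarrow> \<bar>h r \<omega>\<bar> \<le> B"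
  shows "integrable M (\<lambda>\<omega>. LINT r:{s..t}|lborel. h r \<omega>)"
    and "set_integrable lborel {s..t} (\<lambda>r. \<integral>\<omega>. h r \<omega> \<partial>M)"
    and "(\<integral>\<omega>. (LINT r:{s..t}|lborel. h r \<omega>) \<partial>M) = (LINT r:{s..t}|lborel. (\<integral>\<omega>. h r \<omega> \<partial>M))"
proof -
  interpret L: pair_sigma_finite lborel M ..
  have [measurable]: "(\<lambda>(r, \<omega>). h r \<omega>) \<in> borel_measurable (lborel \<Otimes>\<^sub>M M)"
    using borel_measurable_continuous_process[OF cont meas]
    by (simp cong: measurable_cong_sets sets_pair_measure_cong)
  have int: "integrable (lborel \<Otimes>\<^sub>M M) (\<lambda>(r, \<omega>). indicator {s..t} r *\<^sub>R h r \<omega>)"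
  proof (rule Bochner_Integration.integrable_bound[where f = "\<lambda>z. B * indicator ({s..t} \<times> space M) z"])
    have "emeasure (lborel \<Otimes>\<^sub>M M) ({s..t} \<times> space M) < \<infinity>"
      by (subst emeasure_pair_measure_Times)
        (auto simp: emeasure_lborel_Icc_eq ennreal_mult_less_top emeasure_eq_measure)
    then show "integrable (lborel \<Otimes>\<^sub>M M) (\<lambda>z. B * indicator ({s..t} \<times> space M) z)"
      by (intro integrable_mult_right integrable_real_indicator) auto
    have "\<bar>indicator {s..t} r * h r \<omega>\<bar> \<le> \<bar>B * indicator ({s..t} \<times> space M) (r, \<omega>)\<bar>"
      if "\<omega> \<in> space M" for r \<omega>
      using bdd[OF that, of r] that by (auto simp: indicator_def)
    then show "AE z in lborel \<Otimes>\<^sub>M M. norm (case z of (r, \<omega>) \<Rightarrow> indicator {s..t} r *\<^sub>R h r \<omega>)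
         \<le> norm (B * indicator ({s..t} \<times> space M) z)"
      by (intro AE_I2) (auto simp: space_pair_measure)
  qed measurable
  show "integrable M (\<lambda>\<omega>. LINT r:{s..t}|lborel. h r \<omega>)"
    using L.integrable_snd[OF int] by (simp add: set_lebesgue_integral_def)
  show "set_integrable lborel {s..t} (\<lambda>r. \<integral>\<omega>. h r \<omega> \<partial>M)"
    using L.integrable_fst[OF int] by (simp add: set_integrable_def)
  show "(\<integral>\<omega>. (LINT r:{s..t}|lborel. h r \<omega>) \<partial>M) = (LINT r:{s..t}|lborel. (\<integral>\<omega>. h r \<omega> \<partial>M))"
    using L.Fubini_integral[OF int] by (simp add: set_lebesgue_integral_def)
qed

lemma space_coord_sigma [simp]: "space (coord_sigma n T) = Paths n"
  unfolding coord_sigma_def by (rule space_measure_of) auto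

lemma sets_coord_sigma:
  "sets (coord_sigma n T) =
     sigma_sets (Paths n) {{\<omega> \<in> Paths n. \<omega> s l \<in> A} | s l A. s \<in> T \<and> A \<in> sets borel}"
  unfolding coord_sigma_def by (rule sets_measure_of) auto

lemma sets_coord_sigma_mono: "T \<subseteq> T' \<Longrightarrow> sets (coord_sigma n T) \<subseteq> sets (coord_sigma n T')"
  unfolding sets_coord_sigma by (rule sigma_sets_subseteq) blast

lemma PathsD:
  assumes "\<omega> \<in> Paths n"
  shows "continuous_on UNIV \<omega>" "\<omega> t \<in> Estate n" "t \<le> 0 \<Longrightarrow> \<omega> t = \<omega> 0"
  using assms unfolding Paths_def by blast+

lemma continuous_on_Paths_compose:
  assumes "\<omega> \<in> Paths n" "continuous_on (Estate n) h"
  shows "continuous_on A (\<lambda>r. h (\<omega> r))"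
  by (rule continuous_on_subset[OF continuous_on_compose2[OF assms(2) PathsD(1)[OF assms(1)]]])
     (use PathsD(2)[OF assms(1)] in auto)

lemma measurable_eval_coord_sigma:
  assumes "s \<in> T"
  shows "(\<lambda>\<omega>. \<omega> s) \<in> borel_measurable (coord_sigma n T)"
proof (intro measurable_coordinatewise_then_product measurableI)
  fix l and A :: "real set" assume "A \<in> sets borel"
  then have "{\<omega> \<in> Paths n. \<omega> s l \<in> A} \<in> sets (coord_sigma n T)"
    unfolding sets_coord_sigma using assms by (intro sigma_sets.Basic) blast
  also have "{\<omega> \<in> Paths n. \<omega> s l \<in> A} = (\<lambda>\<omega>. \<omega> s l) -` A \<inter> space (coord_sigma n T)" by auto
  finally show "(\<lambda>\<omega>. \<omega> s l) -` A \<inter> space (coord_sigma n T) \<in> sets (coord_sigma n T)" .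
qed simp

lemma borel_measurable_coord_sigma:
  fixes h :: "(nat \<Rightarrow> real) \<Rightarrow> 'b::topological_space"
  assumes "continuous_on (Estate n) h" "s \<in> T"
  shows "(\<lambda>\<omega>. h (\<omega> s)) \<in> borel_measurable (coord_sigma n T)"
proof (rule measurable_compose[where f = "\<lambda>\<omega>. \<omega> s" and g = h])
  show "(\<lambda>\<omega>. \<omega> s) \<in> coord_sigma n T \<rightarrow>\<^sub>M restrict_space borel (Estate n)"
    by (intro measurable_restrict_space2 measurable_eval_coord_sigma assms) (auto dest: PathsD)
  show "h \<in> borel_measurable (restrict_space borel (Estate n))"
    by (rule borel_measurable_continuous_on_restrict[OF assms(1)])
qed

locale MP_solution =
  fixes n :: nat and L :: "((nat \<Rightarrow> real) \<Rightarrow> real) \<Rightarrow> (nat \<Rightarrow> real) \<Rightarrow> real"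
    and P :: "(real \<Rightarrow> nat \<Rightarrow> real) measure"
  assumes solves_MP: "solves_MP n L P"
begin

lemma prob_space_P: "prob_space P" and sets_P: "sets P = sets (PathSpace n)"
  using solves_MP unfolding solves_MP_def by blast+

sublocale prob_space P by (rule prob_space_P)

lemma space_P [simp]: "space P = Paths n"
  using sets_eq_imp_space_eq[OF sets_P] by simp

lemma prob_Paths [simp]: "prob (Paths n) = 1"
  using prob_space by simp

lemma borel_measurable_path:
  fixes h :: "(nat \<Rightarrow> real) \<Rightarrow> 'b::topological_space"
  assumes "continuous_on (Estate n) h"
  shows "(\<lambda>\<omega>. h (\<omega> t)) \<in> borel_measurable P"
proof -
  have "(\<lambda>\<omega>. h (\<omega> (max 0 t))) \<in> borel_measurable P"
    unfolding measurable_cong_sets[OF sets_P refl] by (rule borel_measurable_coord_sigma[OF assms]) simp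
  moreover have "h (\<omega> (max 0 t)) = h (\<omega> t)" if "\<omega> \<in> space P" for \<omega>
    using that PathsD(3)[of \<omega> n t] by (cases "t \<le> 0") auto
  ultimately show ?thesis by (rule measurable_cong[THEN iffD1, rotated])
qed

lemma integrable_bounded:
  fixes f :: "(real \<Rightarrow> nat \<Rightarrow> real) \<Rightarrow> real"
  assumes "f \<in> borel_measurable P" "\<And>\<omega>. \<omega> \<in> Paths n \<Longrightarrow> \<bar>f \<omega>\<bar> \<le> B"
  shows "integrable P f"
  by (rule integrable_const_bound[where B = B]) (use assms in \<open>auto intro!: AE_I2\<close>)

lemma integrable_mult_bounded:
  fixes f h :: "(real \<Rightarrow> nat \<Rightarrow> real) \<Rightarrow> real"
  assumes "f \<in> borel_measurable P" "h \<in> borel_measurable P"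
    and f_le: "\<And>\<omega>. \<omega> \<in> Paths n \<Longrightarrow> \<bar>f \<omega>\<bar> \<le> B" and h_le: "\<And>\<omega>. \<omega> \<in> Paths n \<Longrightarrow> \<bar>h \<omega>\<bar> \<le> C"
  shows "integrable P (\<lambda>\<omega>. f \<omega> * h \<omega>)"
proof (rule integrable_bounded[where B = "B * C"])
  show "\<bar>f \<omega> * h \<omega>\<bar> \<le> B * C" if "\<omega> \<in> Paths n" for \<omega>
    unfolding abs_mult using f_le[OF that] h_le[OF that] by (intro mult_mono) auto
qed (intro borel_measurable_times assms)

lemma subalgebra_coord_sigma: "0 \<le> s \<Longrightarrow> subalgebra P (coord_sigma n {0..s})"
  unfolding subalgebra_def using sets_coord_sigma_mono[of "{0..s}" "{0..}" n] by (simp add: sets_P)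

lemma
  assumes f: "testfun n f" and st: "0 \<le> s" "s \<le> t"
  shows integrable_martingale_increment: "integrable P (\<lambda>\<omega>. mart_fun L f t \<omega> - mart_fun L f s \<omega>)"
    and cond_exp_martingale_increment:
      "AE \<omega> in P. real_cond_exp P (coord_sigma n {0..s}) (\<lambda>\<omega>. mart_fun L f t \<omega> - mart_fun L f s \<omega>) \<omega> = 0"
proof -
  let ?F = "coord_sigma n {0..s}" and ?N = "\<lambda>\<omega>. mart_fun L f t \<omega> - mart_fun L f s \<omega>"
  interpret F: finite_measure_subalgebra P ?F
    by unfold_locales (rule subalgebra_coord_sigma[OF st(1)])
  have "0 \<le> t" using st by simp
  with f have int: "integrable P (mart_fun L f t)" "integrable P (mart_fun L f s)"
    and mart: "\<And>E. E \<in> sets ?F \<Longrightarrow>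
      set_lebesgue_integral P E (mart_fun L f t) = set_lebesgue_integral P E (mart_fun L f s)"
    using solves_MP st unfolding solves_MP_def by blast+
  show int_N: "integrable P ?N" using int by simp
  have "set_lebesgue_integral P E ?N = set_lebesgue_integral P E (\<lambda>_. 0)" if E: "E \<in> sets ?F" for E
  proof -
    have "E \<in> sets P" using E F.subalg by (auto simp: subalgebra_def)
    then have "set_integrable P E (mart_fun L f t)" "set_integrable P E (mart_fun L f s)"
      unfolding set_integrable_def using int
      by (auto intro!: integrable_mult_indicator simp del: real_scaleR_def)
    then have "set_lebesgue_integral P E ?N = 0"
      using mart[OF E] by (simp add: set_integral_diff)
    then show ?thesis by (simp add: set_lebesgue_integral_def)
  qed
  then show "AE \<omega> in P. real_cond_exp P ?F ?N \<omega> = 0"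
    by (rule F.real_cond_exp_charact[OF _ int_N]) auto
qed

lemma
  assumes f: "testfun n f" and st: "0 \<le> s" "s \<le> t"
    and Y: "Y \<in> borel_measurable (coord_sigma n {0..s})" and Y_le: "\<And>\<omega>. \<omega> \<in> Paths n \<Longrightarrow> \<bar>Y \<omega>\<bar> \<le> B"
  shows integrable_mult_martingale_increment:
      "integrable P (\<lambda>\<omega>. Y \<omega> * (mart_fun L f t \<omega> - mart_fun L f s \<omega>))"
    and martingale_increment_orthogonal:
      "expectation (\<lambda>\<omega>. Y \<omega> * (mart_fun L f t \<omega> - mart_fun L f s \<omega>)) = 0"
proof -
  let ?F = "coord_sigma n {0..s}" and ?N = "\<lambda>\<omega>. mart_fun L f t \<omega> - mart_fun L f s \<omega>"
  interpret F: finite_measure_subalgebra P ?F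
    by unfold_locales (rule subalgebra_coord_sigma[OF st(1)])
  note int_N = integrable_martingale_increment[OF f st]
  have Y_P: "Y \<in> borel_measurable P" by (rule measurable_from_subalg[OF F.subalg Y])
  show int_YN: "integrable P (\<lambda>\<omega>. Y \<omega> * ?N \<omega>)"
  proof (rule Bochner_Integration.integrable_bound[OF integrable_mult_right[OF int_N, of B]])
    have "\<bar>Y \<omega> * ?N \<omega>\<bar> \<le> \<bar>B * ?N \<omega>\<bar>" if "\<omega> \<in> Paths n" for \<omega>
      using Y_le[OF that] by (auto simp: abs_mult intro!: mult_right_mono)
    then show "AE \<omega> in P. norm (Y \<omega> * ?N \<omega>) \<le> norm (B * ?N \<omega>)" by (intro AE_I2) simp
  qed (use Y_P int_N in measurable)
  have "expectation (\<lambda>\<omega>. Y \<omega> * ?N \<omega>) = expectation (\<lambda>\<omega>. Y \<omega> * real_cond_exp P ?F ?N \<omega>)"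
    using F.real_cond_exp_intg(2)[OF int_YN Y] int_N by auto
  also have "\<dots> = 0"
    using cond_exp_martingale_increment[OF f st] by (intro integral_eq_zero_AE) auto
  finally show "expectation (\<lambda>\<omega>. Y \<omega> * ?N \<omega>) = 0" .
qed

lemma mart_fun_diff:
  assumes A: "continuous_on (Estate n) A" "\<And>x. x \<in> Estate n \<Longrightarrow> L f x = A x"
    and st: "0 \<le> s" "s \<le> t" and \<omega>: "\<omega> \<in> Paths n"
  shows "mart_fun L f t \<omega> - mart_fun L f s \<omega> = f (\<omega> t) - f (\<omega> s) - (LINT r:{s..t}|lborel. A (\<omega> r))"
proof -
  have L_A: "(\<lambda>r. L f (\<omega> r)) = (\<lambda>r. A (\<omega> r))" using A(2) PathsD(2)[OF \<omega>] by auto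
  have "0 \<le> t" using st by simp
  then have "interval_lebesgue_integrable lborel 0 (ereal t) (\<lambda>r. A (\<omega> r))"
    using interval_integrable_continuous_on[OF _ continuous_on_Paths_compose[OF \<omega> A(1)]]
    by (simp add: zero_ereal_def)
  then have "(LBINT r=0..ereal s. A (\<omega> r)) + (LBINT r=ereal s..ereal t. A (\<omega> r))
      = (LBINT r=0..ereal t. A (\<omega> r))"
    using st by (intro interval_integral_sum) (simp add: min_def max_def zero_ereal_def)
  then show ?thesis
    using interval_integral_Icc[OF st(2), of "\<lambda>r. A (\<omega> r)"] unfolding mart_fun_def L_A by simp
qed

theorem Dynkin_formula:
  assumes f: "testfun n f"
    and A: "continuous_on (Estate n) A" "\<And>x. x \<in> Estate n \<Longrightarrow> L f x = A x" "\<And>x. x \<in> Estate n \<Longrightarrow> \<bar>A x\<bar> \<le> M"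
    and st: "0 \<le> s" "s \<le> t"
    and Y: "Y \<in> borel_measurable (coord_sigma n {0..s})" and Y_le: "\<And>\<omega>. \<omega> \<in> Paths n \<Longrightarrow> \<bar>Y \<omega>\<bar> \<le> B"
  shows "set_integrable lborel {s..t} (\<lambda>r. expectation (\<lambda>\<omega>. Y \<omega> * A (\<omega> r)))"
    and "expectation (\<lambda>\<omega>. Y \<omega> * (f (\<omega> t) - f (\<omega> s)))
       = (LINT r:{s..t}|lborel. expectation (\<lambda>\<omega>. Y \<omega> * A (\<omega> r)))"
proof -
  have Y_P: "Y \<in> borel_measurable P"
    by (rule measurable_from_subalg[OF subalgebra_coord_sigma[OF st(1)] Y])
  have cont: "continuous_on UNIV (\<lambda>r. Y \<omega> * A (\<omega> r))" if "\<omega> \<in> space P" for \<omega>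
    using that continuous_on_Paths_compose[OF _ A(1)] by (intro continuous_intros) auto
  have meas: "(\<lambda>\<omega>. Y \<omega> * A (\<omega> r)) \<in> borel_measurable P" for r
    by (intro borel_measurable_times Y_P borel_measurable_path A(1))
  have bdd: "\<bar>Y \<omega> * A (\<omega> r)\<bar> \<le> B * M" if "\<omega> \<in> space P" for r \<omega>
  proof -
    have "\<bar>Y \<omega>\<bar> \<le> B" "\<bar>A (\<omega> r)\<bar> \<le> M" using Y_le A(3) PathsD(2) that by auto
    then show ?thesis unfolding abs_mult by (intro mult_mono) auto
  qed
  note Fubini = Fubini_continuous_process[OF cont meas bdd, of s t]
  show "set_integrable lborel {s..t} (\<lambda>r. expectation (\<lambda>\<omega>. Y \<omega> * A (\<omega> r)))" by (rule Fubini(2))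
  note martingale = integrable_mult_martingale_increment[OF f st Y Y_le]
    martingale_increment_orthogonal[OF f st Y Y_le]
  have "expectation (\<lambda>\<omega>. Y \<omega> * (f (\<omega> t) - f (\<omega> s))) = expectation (\<lambda>\<omega>.
      Y \<omega> * (mart_fun L f t \<omega> - mart_fun L f s \<omega>) + (LINT r:{s..t}|lborel. Y \<omega> * A (\<omega> r)))"
    by (intro Bochner_Integration.integral_cong refl)
       (simp add: mart_fun_diff[OF A(1,2) st] set_integral_mult_right algebra_simps)
  also have "\<dots> = expectation (\<lambda>\<omega>. LINT r:{s..t}|lborel. Y \<omega> * A (\<omega> r))"
    using martingale Fubini(1) by simp
  finally show "expectation (\<lambda>\<omega>. Y \<omega> * (f (\<omega> t) - f (\<omega> s)))
      = (LINT r:{s..t}|lborel. expectation (\<lambda>\<omega>. Y \<omega> * A (\<omega> r)))"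
    using Fubini(3) by simp
qed

end

locale stationary_MP_solution = MP_solution +
  assumes stationary: "0 \<le> t \<Longrightarrow> distr P borel (\<lambda>\<omega>. \<omega> t) = distr P borel (\<lambda>\<omega>. \<omega> 0)"
begin

lemma
  fixes h :: "(nat \<Rightarrow> real) \<Rightarrow> real"
  assumes h: "continuous_on (Estate n) h" and t: "0 \<le> t"
  shows expectation_stationary: "expectation (\<lambda>\<omega>. h (\<omega> t)) = expectation (\<lambda>\<omega>. h (\<omega> 0))"
    and integrable_stationary: "integrable P (\<lambda>\<omega>. h (\<omega> t)) \<longleftrightarrow> integrable P (\<lambda>\<omega>. h (\<omega> 0))"
proof -
  let ?h = "\<lambda>x. indicator (Estate n) x * h x"
  have "Estate n = (\<Inter>l\<in>- {1..2*n}. {x. x l = 0})" by (auto simp: Estate_def)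
  moreover have "continuous_on UNIV (\<lambda>x :: nat \<Rightarrow> real. x l)" for l
    by (rule continuous_on_product_coordinates)
  ultimately have "closed (Estate n)" by (auto intro!: closed_Collect_eq)
  then have h_borel [measurable]: "?h \<in> borel_measurable borel"
    using borel_measurable_continuous_on_indicator[OF _ h] by simp
  have meas [measurable]: "(\<lambda>\<omega>. \<omega> s) \<in> borel_measurable P" for s
    by (rule borel_measurable_path[of "\<lambda>x. x"]) simp
  have on_paths: "?h (\<omega> s) = h (\<omega> s)" if "\<omega> \<in> space P" for \<omega> s
    using that PathsD(2) by simp
  note law = stationary[OF t]
  have "expectation (\<lambda>\<omega>. h (\<omega> s)) = (\<integral>x. ?h x \<partial>distr P borel (\<lambda>\<omega>. \<omega> s))" for s
    unfolding integral_distr[OF meas h_borel]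
    by (intro Bochner_Integration.integral_cong refl) (simp add: on_paths)
  then show "expectation (\<lambda>\<omega>. h (\<omega> t)) = expectation (\<lambda>\<omega>. h (\<omega> 0))"
    by (simp only: law)
  have "integrable P (\<lambda>\<omega>. h (\<omega> s)) \<longleftrightarrow> integrable (distr P borel (\<lambda>\<omega>. \<omega> s)) ?h" for s
    unfolding integrable_distr_eq[OF meas h_borel]
    by (intro Bochner_Integration.integrable_cong refl) (simp add: on_paths)
  then show "integrable P (\<lambda>\<omega>. h (\<omega> t)) \<longleftrightarrow> integrable P (\<lambda>\<omega>. h (\<omega> 0))"
    by (simp only: law)
qed

end

lemma stationary_solution_iff: "stationary_solution n L P \<longleftrightarrow> stationary_MP_solution n L P"
  unfolding stationary_solution_def stationary_MP_solution_def stationary_MP_solution_axioms_def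
    MP_solution_def by auto

section \<open>A truncation of the identity\<close>

definition has_C2_derivs :: "(real \<Rightarrow> real) \<Rightarrow> (real \<Rightarrow> real) \<Rightarrow> (real \<Rightarrow> real) \<Rightarrow> bool" where
  "has_C2_derivs \<phi> \<phi>' \<phi>'' \<longleftrightarrow> (\<forall>s. (\<phi> has_real_derivative \<phi>' s) (at s)) \<and>
     (\<forall>s. (\<phi>' has_real_derivative \<phi>'' s) (at s)) \<and> continuous_on UNIV \<phi>''"

lemma has_C2_derivs_continuous:
  assumes "has_C2_derivs \<phi> \<phi>' \<phi>''"
  shows "continuous_on UNIV \<phi>" "continuous_on UNIV \<phi>'" "continuous_on UNIV \<phi>''"
  using assms unfolding has_C2_derivs_def by (auto intro: DERIV_continuous_on)

lemma has_C2_derivs_diff_const: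
  "has_C2_derivs \<phi> \<phi>' \<phi>'' \<Longrightarrow> has_C2_derivs (\<lambda>s. \<phi> s - K) \<phi>' \<phi>''"
  unfolding has_C2_derivs_def by (auto intro!: derivative_eq_intros)

lemma has_C2_derivs_power:
  assumes "has_C2_derivs \<phi> \<phi>' \<phi>''"
  shows "has_C2_derivs (\<lambda>s. \<phi> s ^ k) (\<lambda>s. real k * \<phi> s ^ (k - 1) * \<phi>' s)
    (\<lambda>s. real (k * (k - 1)) * \<phi> s ^ (k - 2) * \<phi>' s ^ 2 + real k * \<phi> s ^ (k - 1) * \<phi>'' s)"
  unfolding has_C2_derivs_def
proof (intro conjI allI)
  have \<phi>: "(\<phi> has_real_derivative \<phi>' s) (at s)" and \<phi>': "(\<phi>' has_real_derivative \<phi>'' s) (at s)" for s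
    using assms unfolding has_C2_derivs_def by auto
  fix s
  show "((\<lambda>s. \<phi> s ^ k) has_real_derivative real k * \<phi> s ^ (k - 1) * \<phi>' s) (at s)"
    by (rule DERIV_cong[OF DERIV_power[OF \<phi>]]) simp
  show "((\<lambda>s. real k * \<phi> s ^ (k - 1) * \<phi>' s) has_real_derivative
      real (k * (k - 1)) * \<phi> s ^ (k - 2) * \<phi>' s ^ 2 + real k * \<phi> s ^ (k - 1) * \<phi>'' s) (at s)"
    by (rule DERIV_cong[OF DERIV_mult[OF DERIV_cmult[OF DERIV_power[OF \<phi>]] \<phi>']])
       (simp add: power2_eq_square numeral_2_eq_2)
qed (intro continuous_intros has_C2_derivs_continuous[OF assms])

text \<open>Constant beyond \<open>R\<close>, so that its powers, composed with a positive definite form, are test functions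
  up to a constant.\<close>
definition trunc_id :: "real \<Rightarrow> real \<Rightarrow> real" where
  "trunc_id R s = R / 3 * (1 - (max 0 (1 - s / R))^3)"

definition trunc_id' :: "real \<Rightarrow> real \<Rightarrow> real" where
  "trunc_id' R s = (max 0 (1 - s / R))^2"

definition trunc_id'' :: "real \<Rightarrow> real \<Rightarrow> real" where
  "trunc_id'' R s = - (2 / R) * max 0 (1 - s / R)"

lemma DERIV_pos_part_power:
  "((\<lambda>x::real. (max 0 x)^(k+2)) has_real_derivative (real k + 2) * (max 0 x)^(k+1)) (at x)"
proof -
  consider (neg) "x < 0" | (pos) "x > 0" | (zero) "x = 0" by linarith
  then show ?thesis
  proof cases
    case neg
    then have "\<forall>\<^sub>F y in nhds x. (max 0 y)^(k+2) = 0"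
      using eventually_nhds_in_open[of "{..<0}" x] by (auto elim!: eventually_mono)
    moreover have "((\<lambda>x. 0) has_real_derivative (real k + 2) * (max 0 x)^(k+1)) (at x)"
      using neg by simp
    ultimately show ?thesis by (subst DERIV_cong_ev[OF refl _ refl])
  next
    case pos
    then have "\<forall>\<^sub>F y in nhds x. (max 0 y)^(k+2) = y^(k+2)"
      using eventually_nhds_in_open[of "{0<..}" x] by (auto elim!: eventually_mono)
    moreover have "((\<lambda>x. x^(k+2)) has_real_derivative (real k + 2) * (max 0 x)^(k+1)) (at x)"
      using pos by (intro DERIV_cong[OF DERIV_pow]) simp
    ultimately show ?thesis by (subst DERIV_cong_ev[OF refl _ refl])
  next
    case zero
    have "((\<lambda>h::real. (max 0 h)^(k+1)) \<longlongrightarrow> (max 0 0)^(k+1)) (at 0)"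
      by (intro tendsto_intros)
    moreover have "(max 0 h)^(k+1) = ((max 0 h)^(k+2) - (max 0 0)^(k+2)) / (h - 0)"
      if "h \<noteq> 0" for h :: real
      using that by (cases "h > 0") auto
    ultimately have "((\<lambda>h::real. ((max 0 h)^(k+2) - (max 0 0)^(k+2)) / (h - 0)) \<longlongrightarrow> 0) (at 0)"
      by (auto intro: Lim_transform_eventually simp: eventually_at_filter)
    then show ?thesis using zero by (simp add: has_field_derivative_iff)
  qed
qed

lemma has_C2_derivs_trunc_id:
  assumes "R > 0"
  shows "has_C2_derivs (trunc_id R) (trunc_id' R) (trunc_id'' R)"
  unfolding has_C2_derivs_def
proof (intro conjI allI)
  fix s
  have inner: "((\<lambda>s. 1 - s / R) has_real_derivative - 1 / R) (at s)"
    using assms by (auto intro!: derivative_eq_intros)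
  have "((\<lambda>s. (max 0 (1 - s / R))^3) has_real_derivative - (3 / R) * (max 0 (1 - s / R))^2) (at s)"
    using DERIV_chain2[OF DERIV_pos_part_power[of 1] inner] by (simp add: numeral_3_eq_3 numeral_2_eq_2)
  from DERIV_cmult[OF DERIV_diff[OF DERIV_const this], of "R / 3" 1]
  show "(trunc_id R has_real_derivative trunc_id' R s) (at s)"
    unfolding trunc_id_def[abs_def] trunc_id'_def by (rule DERIV_cong) (use assms in simp)
  show "(trunc_id' R has_real_derivative trunc_id'' R s) (at s)"
    using DERIV_chain2[OF DERIV_pos_part_power[of 0] inner]
    by (simp add: trunc_id'_def[abs_def] trunc_id''_def numeral_2_eq_2)
  show "continuous_on UNIV (trunc_id'' R)"
    unfolding trunc_id''_def[abs_def] by (intro continuous_intros) (use assms in auto)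
qed

lemma trunc_id_eq:
  assumes "R > 0" "R \<le> s"
  shows "trunc_id R s = R / 3" "trunc_id' R s = 0" "trunc_id'' R s = 0"
proof -
  have "max 0 (1 - s / R) = 0" using assms by simp
  then show "trunc_id R s = R / 3" "trunc_id' R s = 0" "trunc_id'' R s = 0"
    by (simp_all add: trunc_id_def trunc_id'_def trunc_id''_def)
qed

lemma trunc_id_deriv_bounds:
  assumes "R > 0" "s \<ge> 0"
  shows "0 \<le> trunc_id' R s" "trunc_id' R s \<le> 1" "trunc_id'' R s \<le> 0" "\<bar>trunc_id'' R s\<bar> \<le> 2 / R"
proof -
  let ?y = "max 0 (1 - s / R)"
  have y: "0 \<le> ?y" "?y \<le> 1" using assms by auto
  show "0 \<le> trunc_id' R s" "trunc_id' R s \<le> 1"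
    unfolding trunc_id'_def using y by (auto intro: power_le_one)
  show "trunc_id'' R s \<le> 0"
    using assms(1) y by (simp add: trunc_id''_def divide_nonpos_pos mult_nonneg_nonneg)
  have "\<bar>trunc_id'' R s\<bar> = 2 / R * ?y" using assms(1) y by (simp add: trunc_id''_def abs_mult)
  also have "\<dots> \<le> 2 / R * 1" using assms(1) y by (intro mult_left_mono) auto
  finally show "\<bar>trunc_id'' R s\<bar> \<le> 2 / R" by simp
qed

lemma trunc_id_bounds:
  assumes "R > 0" "s \<ge> 0"
  shows "0 \<le> trunc_id R s" "trunc_id R s \<le> s" "trunc_id R s \<le> R" "s - s^2 / R \<le> trunc_id R s"
proof -
  define y where "y = max 0 (1 - s / R)"
  have y: "0 \<le> y" "y \<le> 1" "1 - y \<le> s / R" "y^3 \<le> 1"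
    using assms by (auto simp: y_def intro: power_le_one)
  have id: "trunc_id R s = R / 3 * (1 - y^3)" by (simp add: trunc_id_def y_def)
  show "0 \<le> trunc_id R s" using y(4) assms(1) by (simp add: id)
  have "trunc_id R s \<le> R / 3 * 1" unfolding id using y(1) assms(1) by (intro mult_left_mono) auto
  then show "trunc_id R s \<le> R" using assms(1) by simp
  have error: "1 - y^3 = 3 * (1 - y) - (1 - y)^2 * (2 + y)"
    by (simp add: power2_eq_square power3_eq_cube algebra_simps)
  then have "1 - y^3 \<le> 3 * (1 - y)" using y(1) by simp
  also have "\<dots> \<le> 3 * (s / R)" using y(3) by simp
  finally have "R / 3 * (1 - y^3) \<le> R / 3 * (3 * (s / R))" using assms(1) by (intro mult_left_mono) auto
  then show "trunc_id R s \<le> s" unfolding id using assms(1) by simp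
  show "s - s^2 / R \<le> trunc_id R s"
  proof (cases "s \<le> R")
    case True
    then have "1 - y = s / R" using assms(1) by (simp add: y_def)
    then have "1 - y^3 \<ge> 3 * (s / R) - (s / R)^2 * 3"
      unfolding error using y(2) mult_left_mono[of "2 + y" 3 "(s / R)^2"] by simp
    then have "R / 3 * (3 * (s / R) - (s / R)^2 * 3) \<le> trunc_id R s"
      unfolding id using assms(1) by (intro mult_left_mono) auto
    moreover have "R / 3 * (3 * (s / R) - (s / R)^2 * 3) = s - s^2 / R"
      using assms(1) by (simp add: power2_eq_square field_simps)
    ultimately show ?thesis by (simp only:)
  next
    case False
    then have "s \<le> s^2 / R" using assms by (simp add: power2_eq_square field_simps)
    then show ?thesis using \<open>0 \<le> trunc_id R s\<close> by linarith
  qed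
qed

lemma
  assumes "s \<ge> 0"
  shows trunc_id_tendsto: "(\<lambda>k. trunc_id (real (Suc k)) s) \<longlonglongrightarrow> s"
    and trunc_id'_tendsto: "(\<lambda>k. trunc_id' (real (Suc k)) s) \<longlonglongrightarrow> 1"
proof -
  have lim: "(\<lambda>k. c / real (Suc k)) \<longlonglongrightarrow> 0" for c :: real
    using lim_const_over_n[of c] by (rule LIMSEQ_Suc)
  have "(\<lambda>k. (max 0 (1 - s / real (Suc k)))^2) \<longlonglongrightarrow> (max 0 (1 - 0))^2"
    by (intro tendsto_intros lim)
  then show "(\<lambda>k. trunc_id' (real (Suc k)) s) \<longlonglongrightarrow> 1" by (simp add: trunc_id'_def)
  have "(\<lambda>k. s - s^2 / real (Suc k)) \<longlonglongrightarrow> s - 0"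
    by (intro tendsto_intros lim)
  then have lower: "(\<lambda>k. s - s^2 / real (Suc k)) \<longlonglongrightarrow> s" by simp
  show "(\<lambda>k. trunc_id (real (Suc k)) s) \<longlonglongrightarrow> s"
    by (rule real_tendsto_sandwich[OF _ _ lower tendsto_const])
       (use assms in \<open>auto intro!: always_eventually trunc_id_bounds simp del: of_nat_Suc\<close>)
qed

section \<open>Moments and increments of a dissipative functional\<close>

lemma Fatou_integral_bound:
  fixes f :: "nat \<Rightarrow> 'a \<Rightarrow> real"
  assumes int: "\<And>k. integrable M (f k)" and nonneg: "\<And>k x. x \<in> space M \<Longrightarrow> 0 \<le> f k x"
    and lim: "\<And>x. x \<in> space M \<Longrightarrow> (\<lambda>k. f k x) \<longlonglongrightarrow> g x"
    and bound: "\<And>k. (\<integral>x. f k x \<partial>M) \<le> C"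
  shows "integrable M g" "(\<integral>x. g x \<partial>M) \<le> C"
proof -
  have [measurable]: "f k \<in> borel_measurable M" for k using int by auto
  have [measurable]: "g \<in> borel_measurable M"
    using lim by (rule borel_measurable_LIMSEQ_real) measurable
  have g: "0 \<le> g x" if "x \<in> space M" for x
    using LIMSEQ_le_const[OF lim[OF that]] nonneg[OF that] by blast
  have C: "0 \<le> C"
    using order_trans[OF Bochner_Integration.integral_nonneg[OF nonneg] bound[of 0]] by blast
  have "(\<integral>\<^sup>+x. ennreal (g x) \<partial>M) = (\<integral>\<^sup>+x. liminf (\<lambda>k. ennreal (f k x)) \<partial>M)"
    by (intro nn_integral_cong lim_imp_Liminf[symmetric] tendsto_ennrealI lim) auto
  also have "\<dots> \<le> liminf (\<lambda>k. \<integral>\<^sup>+x. ennreal (f k x) \<partial>M)" by (rule nn_integral_liminf) measurable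
  also have "\<dots> = liminf (\<lambda>k. ennreal (\<integral>x. f k x \<partial>M))"
    using int nonneg by (intro arg_cong[where f = liminf] ext nn_integral_eq_integral AE_I2)
  also have "\<dots> \<le> liminf (\<lambda>k::nat. ennreal C)"
    by (intro Liminf_mono always_eventually allI ennreal_leI bound)
  also have "\<dots> = ennreal C" by (simp add: Liminf_const)
  finally have nn_le: "(\<integral>\<^sup>+x. ennreal (g x) \<partial>M) \<le> ennreal C" .
  show int_g: "integrable M g"
    by (rule integrableI_nonneg) (use g le_less_trans[OF nn_le ennreal_less_top] in auto)
  have "ennreal (\<integral>x. g x \<partial>M) \<le> ennreal C"
    using nn_le int_g g by (subst nn_integral_eq_integral[symmetric]) auto
  then show "(\<integral>x. g x \<partial>M) \<le> C" using C by simp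
qed

lemma binomial_increment:
  fixes y z :: real
  assumes "0 < m"
  shows "(\<Sum>k\<le>m. real (m choose k) * (- y)^(m - k) * (z^k - y^k)) = (z - y)^m"
proof -
  have "(\<Sum>k\<le>m. real (m choose k) * (- y)^(m - k) * x^k) = (x - y)^m" for x
    using binomial_ring[of x "- y" m] by (simp add: mult_ac)
  then show ?thesis using assms by (simp add: right_diff_distrib sum_subtractf)
qed

lemma binomial_deriv:
  fixes y z :: real
  shows "(\<Sum>k\<le>m. real (m choose k) * (- y)^(m - k) * (real k * z^(k - 1))) = real m * (z - y)^(m - 1)"
proof (rule DERIV_unique)
  have "(\<lambda>z. (z - y)^m) = (\<lambda>z. \<Sum>k\<le>m. real (m choose k) * (- y)^(m - k) * z^k)"
    using binomial_ring[of _ "- y" m] by (auto simp: fun_eq_iff mult_ac)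
  then show "((\<lambda>z. (z - y)^m) has_real_derivative
      (\<Sum>k\<le>m. real (m choose k) * (- y)^(m - k) * (real k * z^(k - 1)))) (at z)"
    by (auto intro!: derivative_eq_intros sum.cong)
  show "((\<lambda>z. (z - y)^m) has_real_derivative real m * (z - y)^(m - 1)) (at z)"
    by (auto intro!: derivative_eq_intros)
qed

lemma binomial_deriv2:
  fixes y z :: real
  shows "(\<Sum>k\<le>m. real (m choose k) * (- y)^(m - k) * (real (k * (k - 1)) * z^(k - 2)))
    = real (m * (m - 1)) * (z - y)^(m - 2)"
proof (rule DERIV_unique)
  have "(\<lambda>z. real m * (z - y)^(m - 1))
      = (\<lambda>z. \<Sum>k\<le>m. real (m choose k) * (- y)^(m - k) * (real k * z^(k - 1)))"
    by (simp only: binomial_deriv)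
  then show "((\<lambda>z. real m * (z - y)^(m - 1)) has_real_derivative
      (\<Sum>k\<le>m. real (m choose k) * (- y)^(m - k) * (real (k * (k - 1)) * z^(k - 2)))) (at z)"
    by (auto intro!: derivative_eq_intros sum.cong simp: numeral_2_eq_2)
  show "((\<lambda>z. real m * (z - y)^(m - 1)) has_real_derivative real (m * (m - 1)) * (z - y)^(m - 2)) (at z)"
    by (auto intro!: derivative_eq_intros simp: numeral_2_eq_2)
qed

definition moment_bound :: "real \<Rightarrow> real \<Rightarrow> real \<Rightarrow> nat \<Rightarrow> real" where
  "moment_bound A \<gamma> g k = (\<Prod>i<k. (A + real i * g) / \<gamma>)"

definition drift_bound :: "real \<Rightarrow> real \<Rightarrow> real \<Rightarrow> real" where
  "drift_bound A B g = 4 * A + 6 * (B + 2 * g) + 6 * g"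

definition drift_sq_bound :: "real \<Rightarrow> real \<Rightarrow> real \<Rightarrow> real \<Rightarrow> real" where
  "drift_sq_bound A B \<gamma> g = 3 * (drift_bound A B g)^2 * (1 + 2 * moment_bound A \<gamma> g 4)"

definition increment_bound :: "real \<Rightarrow> real \<Rightarrow> real \<Rightarrow> real \<Rightarrow> real" where
  "increment_bound A B \<gamma> g = ((2 * moment_bound A \<gamma> g 4 + drift_sq_bound A B \<gamma> g) / 2
      + drift_sq_bound A B \<gamma> g) / 2"

lemma moment_bound_Suc: "moment_bound A \<gamma> g (Suc k) = (A + real k * g) / \<gamma> * moment_bound A \<gamma> g k"
  by (simp add: moment_bound_def mult.commute)

lemma moment_bound_nonneg: "0 \<le> A \<Longrightarrow> 0 < \<gamma> \<Longrightarrow> 0 \<le> g \<Longrightarrow> 0 \<le> moment_bound A \<gamma> g k"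
  unfolding moment_bound_def by (intro prod_nonneg) auto

lemma drift_sq_bound_nonneg: "0 \<le> A \<Longrightarrow> 0 < \<gamma> \<Longrightarrow> 0 \<le> g \<Longrightarrow> 0 \<le> drift_sq_bound A B \<gamma> g"
  unfolding drift_sq_bound_def using moment_bound_nonneg[of A \<gamma> g 4] by simp

lemma drift_growth_le:
  fixes u v A g e :: real
  assumes nonneg: "0 \<le> u" "0 \<le> v" "0 \<le> A" "0 \<le> e" "0 \<le> g"
  shows "(4 * ((u + v) * (A + e * u)) + 12 * (g * u))^2
    \<le> 3 * (4 * A + 6 * e + 6 * g)^2 * (1 + u^4 + v^4)"
proof -
  let ?h = "4 * A + 6 * e + 6 * g"
  have "?h * (1 + u^2 + v^2) - (4 * ((u + v) * (A + e * u)) + 12 * (g * u)) =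
      2 * A * ((u - 1)^2 + (v - 1)^2 + u^2 + v^2) + 2 * e * ((u - v)^2 + 3 + 2 * v^2)
      + 6 * g * ((u - 1)^2 + v^2)"
    by (simp add: power2_eq_square algebra_simps)
  also have "\<dots> \<ge> 0" using nonneg by simp
  finally have "(4 * ((u + v) * (A + e * u)) + 12 * (g * u))^2 \<le> (?h * (1 + u^2 + v^2))^2"
    using nonneg by (intro power_mono) auto
  also have "\<dots> = ?h^2 * (1 + u^2 + v^2)^2" by (rule power_mult_distrib)
  also have "\<dots> \<le> ?h^2 * (3 * (1 + u^4 + v^4))"
  proof (rule mult_left_mono)
    have "0 \<le> (u^2 - 1)^2 + (v^2 - 1)^2 + (u^2 - v^2)^2" by simp
    then show "(1 + u^2 + v^2)^2 \<le> 3 * (1 + u^4 + v^4)"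
      by (simp add: power2_eq_square power4_eq_xxxx algebra_simps)
  qed simp
  finally show ?thesis by (simp only: mult_ac)
qed

lemma power4_drift_le:
  fixes d l m u v A g e \<theta> :: real
  assumes d: "\<bar>d\<bar> \<le> u + v" and l: "\<bar>l\<bar> \<le> A + e * u" and m: "0 \<le> m" "m \<le> g * u"
    and nonneg: "0 \<le> u" "0 \<le> v" "0 \<le> A" "0 \<le> e" "0 \<le> g" and \<theta>: "0 < \<theta>"
  shows "4 * d^3 * l + 12 * d^2 * m
    \<le> (d^4 / \<theta> + \<theta> * (3 * (4 * A + 6 * e + 6 * g)^2 * (1 + u^4 + v^4))) / 2"
proof -
  define H where "H = 4 * ((u + v) * (A + e * u)) + 12 * (g * u)"
  have "d * l \<le> (u + v) * (A + e * u)"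
    using abs_ge_self[of "d * l"] mult_mono[OF d l] nonneg by (simp add: abs_mult)
  then have "4 * (d * l) + 12 * m \<le> H" using m by (simp add: H_def)
  then have "d^2 * (4 * (d * l) + 12 * m) \<le> d^2 * H" by (rule mult_left_mono) simp
  then have "4 * d^3 * l + 12 * d^2 * m \<le> d^2 * H"
    by (simp add: power2_eq_square power3_eq_cube algebra_simps)
  also have "\<dots> \<le> (d^4 / \<theta> + \<theta> * H^2) / 2"
  proof -
    have "0 \<le> (d^2 - \<theta> * H)^2 / \<theta>" using \<theta> by simp
    also have "\<dots> = d^4 / \<theta> + \<theta> * H^2 - 2 * (d^2 * H)"
      using \<theta> by (simp add: power2_eq_square power4_eq_xxxx field_simps)
    finally show ?thesis by simp
  qed
  also have "\<dots> \<le> (d^4 / \<theta> + \<theta> * (3 * (4 * A + 6 * e + 6 * g)^2 * (1 + u^4 + v^4))) / 2"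
    unfolding H_def using \<theta> nonneg
    by (intro divide_right_mono add_left_mono mult_left_mono drift_growth_le) auto
  finally show ?thesis .
qed

locale dissipative_functional = stationary_MP_solution n L P
  for n :: nat and L :: "((nat \<Rightarrow> real) \<Rightarrow> real) \<Rightarrow> (nat \<Rightarrow> real) \<Rightarrow> real"
    and P :: "(real \<Rightarrow> nat \<Rightarrow> real) measure" +
  fixes q D G :: "(nat \<Rightarrow> real) \<Rightarrow> real" and A B \<gamma> g :: real
  assumes continuous: "continuous_on (Estate n) q" "continuous_on (Estate n) D" "continuous_on (Estate n) G"
    and testfun_compose: "has_C2_derivs \<phi> \<phi>' \<phi>'' \<Longrightarrow> (\<And>s. s \<ge> R \<Longrightarrow> \<phi> s = 0) \<Longrightarrow> testfun n (\<lambda>x. \<phi> (q x))"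
    and L_compose: "has_C2_derivs \<phi> \<phi>' \<phi>'' \<Longrightarrow> x \<in> Estate n \<Longrightarrow>
      L (\<lambda>x. \<phi> (q x)) x = \<phi>' (q x) * D x + \<phi>'' (q x) * G x"
    and q_nonneg: "0 \<le> q x"
    and D_le: "D x \<le> A - \<gamma> * q x" and abs_D_le: "\<bar>D x\<bar> \<le> A + B * q x"
    and G_nonneg: "0 \<le> G x" and G_le: "G x \<le> g * q x"
    and constants: "0 \<le> A" "0 \<le> B" "0 < \<gamma>" "0 \<le> g"
begin

definition trunc_q :: "real \<Rightarrow> (nat \<Rightarrow> real) \<Rightarrow> real" where
  "trunc_q R x = trunc_id R (q x)"

definition trunc_drift :: "real \<Rightarrow> (nat \<Rightarrow> real) \<Rightarrow> real" where
  "trunc_drift R x = trunc_id' R (q x) * D x + trunc_id'' R (q x) * G x"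

definition trunc_diff :: "real \<Rightarrow> (nat \<Rightarrow> real) \<Rightarrow> real" where
  "trunc_diff R x = trunc_id' R (q x) ^ 2 * G x"

definition power_gen :: "real \<Rightarrow> nat \<Rightarrow> real \<Rightarrow> (nat \<Rightarrow> real) \<Rightarrow> real" where
  "power_gen R k y x = real k * (trunc_q R x - y)^(k - 1) * trunc_drift R x
     + real (k * (k - 1)) * (trunc_q R x - y)^(k - 2) * trunc_diff R x"

lemma continuous_on_compose_q: "continuous_on UNIV \<phi> \<Longrightarrow> continuous_on (Estate n) (\<lambda>x. \<phi> (q x))"
  by (rule continuous_on_compose2[OF _ continuous(1)]) auto

lemma continuous_on_trunc:
  assumes "R > 0"
  shows "continuous_on (Estate n) (trunc_q R)" "continuous_on (Estate n) (trunc_drift R)"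
    "continuous_on (Estate n) (trunc_diff R)"
  unfolding trunc_q_def[abs_def] trunc_drift_def[abs_def] trunc_diff_def[abs_def]
  by (intro continuous_intros continuous continuous_on_compose_q
      has_C2_derivs_continuous[OF has_C2_derivs_trunc_id[OF assms]])+

lemma continuous_on_power_gen: "R > 0 \<Longrightarrow> continuous_on (Estate n) (power_gen R k y)"
  unfolding power_gen_def[abs_def] by (intro continuous_intros continuous_on_trunc)

lemma trunc_q_bounds:
  assumes "R > 0"
  shows "0 \<le> trunc_q R x" "trunc_q R x \<le> q x" "trunc_q R x \<le> R"
  unfolding trunc_q_def using trunc_id_bounds[OF assms q_nonneg] by auto

lemma trunc_coefficients_le:
  assumes R: "R \<ge> 1"
  shows "\<bar>trunc_drift R x\<bar> \<le> A + (B + 2 * g) * q x" "0 \<le> trunc_diff R x" "trunc_diff R x \<le> g * q x"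
proof -
  have R0: "R > 0" using R by simp
  note t = trunc_id_deriv_bounds[OF R0 q_nonneg[of x]]
  have "2 / R \<le> 2" using R by (simp add: field_simps)
  then have "\<bar>trunc_id'' R (q x)\<bar> \<le> 2" using t(4) by linarith
  then have "\<bar>trunc_id'' R (q x) * G x\<bar> \<le> 2 * (g * q x)"
    unfolding abs_mult using G_nonneg[of x] G_le[of x] by (intro mult_mono) auto
  moreover have "\<bar>trunc_id' R (q x) * D x\<bar> \<le> 1 * (A + B * q x)"
    unfolding abs_mult using t abs_D_le[of x] by (intro mult_mono) auto
  ultimately show "\<bar>trunc_drift R x\<bar> \<le> A + (B + 2 * g) * q x"
    unfolding trunc_drift_def by (simp add: algebra_simps)
  show "0 \<le> trunc_diff R x" unfolding trunc_diff_def using G_nonneg by simp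
  have "trunc_diff R x \<le> 1 * (g * q x)"
    unfolding trunc_diff_def using t G_nonneg[of x] G_le[of x] by (intro mult_mono power_le_one) auto
  then show "trunc_diff R x \<le> g * q x" by simp
qed

lemma trunc_coefficients_bounded:
  assumes R: "R \<ge> 1"
  shows "\<bar>trunc_drift R x\<bar> \<le> A + (B + 2 * g) * R" "\<bar>trunc_diff R x\<bar> \<le> g * R"
proof -
  have "\<bar>trunc_drift R x\<bar> \<le> A + (B + 2 * g) * R \<and> \<bar>trunc_diff R x\<bar> \<le> g * R"
  proof (cases "q x \<le> R")
    case True
    have "(B + 2 * g) * q x \<le> (B + 2 * g) * R" "g * q x \<le> g * R"
      using True constants by (auto intro!: mult_left_mono)
    then show ?thesis using trunc_coefficients_le[OF R, of x] by linarith
  next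
    case False
    then show ?thesis using R constants by (simp add: trunc_drift_def trunc_diff_def trunc_id_eq)
  qed
  then show "\<bar>trunc_drift R x\<bar> \<le> A + (B + 2 * g) * R" "\<bar>trunc_diff R x\<bar> \<le> g * R" by auto
qed

lemma power_gen_bounded:
  assumes R: "R \<ge> 1"
  obtains M where "\<And>x. \<bar>power_gen R k 0 x\<bar> \<le> M"
proof
  fix x
  have p: "\<bar>trunc_q R x\<bar>^j \<le> R^j" for j
    using trunc_q_bounds[of R x] R by (intro power_mono) auto
  have "\<bar>real k * trunc_q R x^(k - 1) * trunc_drift R x\<bar> \<le> real k * R^(k - 1) * (A + (B + 2 * g) * R)"
    unfolding abs_mult power_abs using R p trunc_coefficients_bounded[OF R, of x]
    by (intro mult_mono) auto
  moreover have "\<bar>real (k * (k - 1)) * trunc_q R x^(k - 2) * trunc_diff R x\<bar>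
      \<le> real (k * (k - 1)) * R^(k - 2) * (g * R)"
    unfolding abs_mult power_abs using R p trunc_coefficients_bounded[OF R, of x]
    by (intro mult_mono) auto
  ultimately show "\<bar>power_gen R k 0 x\<bar> \<le> real k * R^(k - 1) * (A + (B + 2 * g) * R)
      + real (k * (k - 1)) * R^(k - 2) * (g * R)"
    unfolding power_gen_def by (intro order_trans[OF abs_triangle_ineq]) simp
qed

lemma Dynkin_power:
  assumes R: "R \<ge> 1" and st: "0 \<le> s" "s \<le> t"
    and Y: "Y \<in> borel_measurable (coord_sigma n {0..s})" and Y_le: "\<And>\<omega>. \<omega> \<in> Paths n \<Longrightarrow> \<bar>Y \<omega>\<bar> \<le> b"
  shows "set_integrable lborel {s..t} (\<lambda>r. expectation (\<lambda>\<omega>. Y \<omega> * power_gen R k 0 (\<omega> r)))"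
    and "expectation (\<lambda>\<omega>. Y \<omega> * (trunc_q R (\<omega> t)^k - trunc_q R (\<omega> s)^k))
       = (LINT r:{s..t}|lborel. expectation (\<lambda>\<omega>. Y \<omega> * power_gen R k 0 (\<omega> r)))"
proof -
  have R0: "R > 0" using R by simp
  define f where "f = (\<lambda>x. trunc_q R x^k - (R / 3)^k)"
  note C2 = has_C2_derivs_diff_const[OF has_C2_derivs_power[OF has_C2_derivs_trunc_id[OF R0], of k],
      of "(R / 3)^k"]
  have "testfun n f"
    unfolding f_def trunc_q_def
    by (rule testfun_compose[OF C2, of R]) (simp add: trunc_id_eq[OF R0])
  moreover have "L f x = power_gen R k 0 x" if "x \<in> Estate n" for x
    unfolding f_def trunc_q_def L_compose[OF C2 that] power_gen_def trunc_drift_def trunc_diff_def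
    by (simp add: algebra_simps)
  moreover obtain M where "\<bar>power_gen R k 0 x\<bar> \<le> M" for x
    using power_gen_bounded[OF R] by blast
  ultimately have Dynkin:
    "set_integrable lborel {s..t} (\<lambda>r. expectation (\<lambda>\<omega>. Y \<omega> * power_gen R k 0 (\<omega> r)))"
    "expectation (\<lambda>\<omega>. Y \<omega> * (f (\<omega> t) - f (\<omega> s)))
      = (LINT r:{s..t}|lborel. expectation (\<lambda>\<omega>. Y \<omega> * power_gen R k 0 (\<omega> r)))"
    using Dynkin_formula[OF _ continuous_on_power_gen[OF R0] _ _ st Y Y_le] by blast+
  from Dynkin(1)
  show "set_integrable lborel {s..t} (\<lambda>r. expectation (\<lambda>\<omega>. Y \<omega> * power_gen R k 0 (\<omega> r)))" .
  from Dynkin(2)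
  show "expectation (\<lambda>\<omega>. Y \<omega> * (trunc_q R (\<omega> t)^k - trunc_q R (\<omega> s)^k))
       = (LINT r:{s..t}|lborel. expectation (\<lambda>\<omega>. Y \<omega> * power_gen R k 0 (\<omega> r)))"
    by (simp add: f_def)
qed

lemma expectation_power_gen:
  assumes R: "R \<ge> 1"
  shows "expectation (\<lambda>\<omega>. power_gen R k 0 (\<omega> 0)) = 0"
proof -
  have R0: "R > 0" using R by simp
  have cont: "continuous_on (Estate n) (\<lambda>x. trunc_q R x^k)"
    by (intro continuous_intros continuous_on_trunc R0)
  have int: "integrable P (\<lambda>\<omega>. trunc_q R (\<omega> r)^k)" for r
    using trunc_q_bounds[OF R0]
    by (intro integrable_bounded[where B = "R^k"] borel_measurable_path[OF cont])
       (auto simp: power_abs intro!: power_mono)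
  have "0 = expectation (\<lambda>\<omega>. 1 * (trunc_q R (\<omega> 1)^k - trunc_q R (\<omega> 0)^k))"
    using expectation_stationary[OF cont, of 1]
    by (simp add: Bochner_Integration.integral_diff[OF int int])
  also have "\<dots> = (LINT r:{0..1::real}|lborel. expectation (\<lambda>\<omega>. 1 * power_gen R k 0 (\<omega> r)))"
    by (rule Dynkin_power(2)[where b = 1]) (use R in auto)
  also have "\<dots> = (LINT r:{0..1::real}|lborel. expectation (\<lambda>\<omega>. power_gen R k 0 (\<omega> 0)))"
    unfolding mult_1
    by (intro set_lebesgue_integral_cong allI impI expectation_stationary continuous_on_power_gen R0) auto
  also have "\<dots> = expectation (\<lambda>\<omega>. power_gen R k 0 (\<omega> 0))"
    by (simp add: set_lebesgue_integral_def)
  finally show ?thesis by simp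
qed

lemma power_gen_le:
  assumes R: "R \<ge> 1"
  shows "power_gen R (Suc k) 0 x \<le>
    real (Suc k) * ((A + real k * g) * q x ^ k - \<gamma> * (trunc_q R x ^ k * trunc_id' R (q x) * q x))"
proof -
  have R0: "R > 0" using R by simp
  note p = trunc_q_bounds[OF R0, of x] and t = trunc_id_deriv_bounds[OF R0 q_nonneg[of x]]
  have "trunc_q R x ^ k * trunc_drift R x \<le> A * q x ^ k - \<gamma> * (trunc_q R x ^ k * trunc_id' R (q x) * q x)"
  proof -
    have "trunc_id'' R (q x) * G x \<le> 0" using t(3) G_nonneg by (rule mult_nonpos_nonneg)
    moreover have "trunc_id' R (q x) * D x \<le> trunc_id' R (q x) * (A - \<gamma> * q x)"
      using D_le t by (intro mult_left_mono)
    ultimately have "trunc_drift R x \<le> trunc_id' R (q x) * (A - \<gamma> * q x)"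
      unfolding trunc_drift_def by linarith
    then have "trunc_q R x ^ k * trunc_drift R x \<le> trunc_q R x ^ k * (trunc_id' R (q x) * (A - \<gamma> * q x))"
      using p by (intro mult_left_mono) auto
    moreover have "A * (trunc_q R x ^ k * trunc_id' R (q x)) \<le> A * (q x ^ k * 1)"
      using p t q_nonneg constants by (intro mult_left_mono mult_mono power_mono) auto
    ultimately show ?thesis by (simp add: algebra_simps)
  qed
  moreover have "real k * trunc_q R x ^ (k - 1) * trunc_diff R x \<le> real k * g * q x ^ k"
  proof (cases k)
    case (Suc j)
    have "trunc_q R x ^ j * trunc_diff R x \<le> q x ^ j * (g * q x)"
      using p trunc_coefficients_le[OF R] q_nonneg by (intro mult_mono power_mono) auto
    then have "real k * (trunc_q R x ^ j * trunc_diff R x) \<le> real k * (q x ^ j * (g * q x))"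
      by (rule mult_left_mono) simp
    then show ?thesis using Suc by (simp add: algebra_simps)
  qed simp
  ultimately have "trunc_q R x ^ k * trunc_drift R x + real k * trunc_q R x ^ (k - 1) * trunc_diff R x
      \<le> (A + real k * g) * q x ^ k - \<gamma> * (trunc_q R x ^ k * trunc_id' R (q x) * q x)"
    by (simp add: algebra_simps)
  then have "real (Suc k) * (trunc_q R x ^ k * trunc_drift R x
          + real k * trunc_q R x ^ (k - 1) * trunc_diff R x)
      \<le> real (Suc k) * ((A + real k * g) * q x ^ k - \<gamma> * (trunc_q R x ^ k * trunc_id' R (q x) * q x))"
    by (rule mult_left_mono) simp
  then show ?thesis
    unfolding power_gen_def by (simp add: numeral_2_eq_2 algebra_simps)
qed

lemma trunc_moment_le:
  assumes R: "R \<ge> 1" and int: "integrable P (\<lambda>\<omega>. q (\<omega> 0)^k)"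
  defines "f \<equiv> \<lambda>\<omega>. trunc_q R (\<omega> 0)^k * trunc_id' R (q (\<omega> 0)) * q (\<omega> 0)"
  shows "integrable P f" "expectation f \<le> (A + real k * g) / \<gamma> * expectation (\<lambda>\<omega>. q (\<omega> 0)^k)"
proof -
  have R0: "R > 0" using R by simp
  have "continuous_on (Estate n) (\<lambda>x. trunc_q R x^k * trunc_id' R (q x) * q x)"
    by (intro continuous_intros continuous continuous_on_trunc R0 continuous_on_compose_q
        has_C2_derivs_continuous[OF has_C2_derivs_trunc_id[OF R0]])
  note meas = borel_measurable_path[OF this, of 0, folded f_def]
  have "\<bar>f \<omega>\<bar> \<le> R^k * 1 * R" for \<omega>
  proof (cases "q (\<omega> 0) \<le> R")
    case True
    then show ?thesis
      using trunc_q_bounds[OF R0, of "\<omega> 0"] trunc_id_deriv_bounds[OF R0 q_nonneg[of "\<omega> 0"]]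
        q_nonneg[of "\<omega> 0"]
      unfolding f_def abs_mult power_abs by (intro mult_mono power_mono) auto
  next
    case False
    then show ?thesis using R0 by (simp add: f_def trunc_id_eq)
  qed
  then show int_f: "integrable P f" by (rule integrable_bounded[OF meas])
  obtain M where "\<bar>power_gen R (Suc k) 0 x\<bar> \<le> M" for x
    using power_gen_bounded[OF R] by blast
  then have "integrable P (\<lambda>\<omega>. power_gen R (Suc k) 0 (\<omega> 0))"
    by (intro integrable_bounded[where B = M] borel_measurable_path continuous_on_power_gen R0)
  then have "expectation (\<lambda>\<omega>. power_gen R (Suc k) 0 (\<omega> 0)) \<le>
      expectation (\<lambda>\<omega>. real (Suc k) * ((A + real k * g) * q (\<omega> 0)^k - \<gamma> * f \<omega>))"
    unfolding f_def using int int_f[unfolded f_def] by (intro integral_mono power_gen_le R) auto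
  also have "\<dots> = real (Suc k) * ((A + real k * g) * expectation (\<lambda>\<omega>. q (\<omega> 0)^k) - \<gamma> * expectation f)"
    using int int_f by simp
  finally have "\<gamma> * expectation f \<le> (A + real k * g) * expectation (\<lambda>\<omega>. q (\<omega> 0)^k)"
    unfolding expectation_power_gen[OF R] by (simp add: zero_le_mult_iff)
  then show "expectation f \<le> (A + real k * g) / \<gamma> * expectation (\<lambda>\<omega>. q (\<omega> 0)^k)"
    using constants by (simp add: field_simps)
qed

lemma moment_initial_le:
  "integrable P (\<lambda>\<omega>. q (\<omega> 0)^k) \<and> expectation (\<lambda>\<omega>. q (\<omega> 0)^k) \<le> moment_bound A \<gamma> g k"
proof (induction k)
  case 0
  then show ?case by (simp add: moment_bound_def)
next
  case (Suc k)
  let ?f = "\<lambda>j \<omega>. trunc_q (real (Suc j)) (\<omega> 0)^k * trunc_id' (real (Suc j)) (q (\<omega> 0)) * q (\<omega> 0)"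
  have int: "integrable P (?f j)" for j
    using Suc by (intro trunc_moment_le(1)) auto
  have "expectation (?f j) \<le> (A + real k * g) / \<gamma> * expectation (\<lambda>\<omega>. q (\<omega> 0)^k)" for j
    using Suc by (intro trunc_moment_le(2)) auto
  also have "(A + real k * g) / \<gamma> * expectation (\<lambda>\<omega>. q (\<omega> 0)^k) \<le> moment_bound A \<gamma> g (Suc k)"
    unfolding moment_bound_Suc using Suc constants by (intro mult_left_mono) auto
  finally have expectation_le: "expectation (?f j) \<le> moment_bound A \<gamma> g (Suc k)" for j .
  have "(\<lambda>j. ?f j \<omega>) \<longlonglongrightarrow> q (\<omega> 0)^k * 1 * q (\<omega> 0)" for \<omega>
    unfolding trunc_q_def by (intro tendsto_intros trunc_id_tendsto trunc_id'_tendsto q_nonneg)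
  then have lim: "(\<lambda>j. ?f j \<omega>) \<longlonglongrightarrow> q (\<omega> 0)^Suc k" for \<omega> by (simp add: mult.commute)
  have nonneg: "0 \<le> ?f j \<omega>" for j \<omega>
    using trunc_q_bounds[of "real (Suc j)" "\<omega> 0"]
      trunc_id_deriv_bounds[of "real (Suc j)" "q (\<omega> 0)"] q_nonneg
    by simp
  show ?case
    using Fatou_integral_bound[where M = P and f = ?f and g = "\<lambda>\<omega>. q (\<omega> 0)^Suc k"]
      int nonneg lim expectation_le by blast
qed

theorem
  assumes "0 \<le> t"
  shows integrable_moment: "integrable P (\<lambda>\<omega>. q (\<omega> t)^k)"
    and moment_le: "expectation (\<lambda>\<omega>. q (\<omega> t)^k) \<le> moment_bound A \<gamma> g k"
proof -
  have "continuous_on (Estate n) (\<lambda>x. q x ^ k)" by (intro continuous_intros continuous)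
  note stationary = integrable_stationary[OF this assms] expectation_stationary[OF this assms]
  show "integrable P (\<lambda>\<omega>. q (\<omega> t)^k)" "expectation (\<lambda>\<omega>. q (\<omega> t)^k) \<le> moment_bound A \<gamma> g k"
    unfolding stationary using moment_initial_le[of k] by auto
qed

lemma integrable_trunc_increment:
  assumes "R > 0"
  shows "integrable P (\<lambda>\<omega>. (trunc_q R (\<omega> t) - trunc_q R (\<omega> s))^m)"
proof (rule integrable_bounded)
  have [measurable]: "(\<lambda>\<omega>. trunc_q R (\<omega> r)) \<in> borel_measurable P" for r
    by (rule borel_measurable_path[OF continuous_on_trunc(1)[OF assms]])
  show "(\<lambda>\<omega>. (trunc_q R (\<omega> t) - trunc_q R (\<omega> s))^m) \<in> borel_measurable P" by measurable
  show "\<bar>(trunc_q R (\<omega> t) - trunc_q R (\<omega> s))^m\<bar> \<le> R^m" for \<omega>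
    using trunc_q_bounds[OF assms, of "\<omega> t"] trunc_q_bounds[OF assms, of "\<omega> s"]
    unfolding power_abs by (intro power_mono) auto
qed

lemma power_gen_binomial:
  "(\<Sum>k\<le>m. real (m choose k) * (- y)^(m - k) * power_gen R k 0 x) = power_gen R m y x"
proof -
  let ?b = "\<lambda>k. real (m choose k) * (- y)^(m - k)"
  have "(\<Sum>k\<le>m. ?b k * power_gen R k 0 x)
      = (\<Sum>k\<le>m. ?b k * (real k * trunc_q R x^(k - 1))) * trunc_drift R x
      + (\<Sum>k\<le>m. ?b k * (real (k * (k - 1)) * trunc_q R x^(k - 2))) * trunc_diff R x"
    unfolding power_gen_def sum_distrib_right sum.distrib[symmetric]
    by (intro sum.cong refl) (simp add: algebra_simps)
  then show ?thesis unfolding binomial_deriv binomial_deriv2 power_gen_def .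
qed

text \<open>The increment depends on two times; expanding it binomially leaves powers of the value at time
  \<open>t\<close> with coefficients known at time \<open>s\<close>, to which Dynkin's formula applies.\<close>
lemma expectation_trunc_increment_power:
  assumes R: "R \<ge> 1" and st: "0 \<le> s" "s \<le> t" and m: "0 < m"
  shows "expectation (\<lambda>\<omega>. (trunc_q R (\<omega> t) - trunc_q R (\<omega> s))^m)
       = (LINT r:{s..t}|lborel. expectation (\<lambda>\<omega>. power_gen R m (trunc_q R (\<omega> s)) (\<omega> r)))"
proof -
  have R0: "R > 0" using R by simp
  let ?p = "\<lambda>r \<omega>. trunc_q R (\<omega> r)"
  define Y where "Y = (\<lambda>k \<omega>. real (m choose k) * (- ?p s \<omega>)^(m - k))"
  have increment: "(?p t \<omega> - ?p s \<omega>)^m = (\<Sum>k\<le>m. Y k \<omega> * (?p t \<omega>^k - ?p s \<omega>^k))" for \<omega>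
    unfolding Y_def by (rule binomial_increment[OF m, symmetric])
  have gen: "power_gen R m (?p s \<omega>) x = (\<Sum>k\<le>m. Y k \<omega> * power_gen R k 0 x)" for \<omega> x
    unfolding Y_def by (rule power_gen_binomial[symmetric])
  have p_le: "\<bar>trunc_q R x\<bar> \<le> R" for x using trunc_q_bounds[OF R0, of x] by simp
  have [measurable]: "?p s \<in> borel_measurable (coord_sigma n {0..s})"
    by (rule borel_measurable_coord_sigma[OF continuous_on_trunc(1)[OF R0]]) (use st in auto)
  have Y_meas: "Y k \<in> borel_measurable (coord_sigma n {0..s})" for k
    unfolding Y_def by measurable
  have Y_le: "\<bar>Y k \<omega>\<bar> \<le> real (m choose k) * R^(m - k)" for k \<omega>
    unfolding Y_def abs_mult power_abs using p_le by (intro mult_mono power_mono) auto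
  note Dynkin = Dynkin_power[OF R st Y_meas Y_le]
  note meas = measurable_from_subalg[OF subalgebra_coord_sigma[OF st(1)] Y_meas]
    borel_measurable_path[OF continuous_on_trunc(1)[OF R0]]
    borel_measurable_path[OF continuous_on_power_gen[OF R0]]
  have "\<bar>trunc_q R x^k - trunc_q R y^k\<bar> \<le> R^k + R^k" for x y k
    using p_le
    by (intro order_trans[OF abs_triangle_ineq4] add_mono) (auto simp: power_abs intro!: power_mono)
  then have int_increment: "integrable P (\<lambda>\<omega>. Y k \<omega> * (?p t \<omega>^k - ?p s \<omega>^k))" for k
    by (intro integrable_mult_bounded[OF _ _ Y_le] borel_measurable_diff borel_measurable_power meas)
  have int_gen: "integrable P (\<lambda>\<omega>. Y k \<omega> * power_gen R k 0 (\<omega> r))" for k r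
  proof -
    obtain M where "\<bar>power_gen R k 0 x\<bar> \<le> M" for x using power_gen_bounded[OF R] by blast
    then show ?thesis by (intro integrable_mult_bounded[OF _ _ Y_le] meas)
  qed
  have "expectation (\<lambda>\<omega>. (?p t \<omega> - ?p s \<omega>)^m)
      = (\<Sum>k\<le>m. expectation (\<lambda>\<omega>. Y k \<omega> * (?p t \<omega>^k - ?p s \<omega>^k)))"
    unfolding increment by (rule Bochner_Integration.integral_sum[OF int_increment])
  also have "\<dots> = (\<Sum>k\<le>m. LINT r:{s..t}|lborel. expectation (\<lambda>\<omega>. Y k \<omega> * power_gen R k 0 (\<omega> r)))"
    by (simp only: Dynkin(2))
  also have "\<dots> = (LINT r:{s..t}|lborel. (\<Sum>k\<le>m. expectation (\<lambda>\<omega>. Y k \<omega> * power_gen R k 0 (\<omega> r))))"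
    using Dynkin(1) unfolding set_lebesgue_integral_def set_integrable_def scaleR_sum_right
    by (intro Bochner_Integration.integral_sum[symmetric])
  also have "\<dots> = (LINT r:{s..t}|lborel. expectation (\<lambda>\<omega>. power_gen R m (?p s \<omega>) (\<omega> r)))"
    unfolding gen by (subst Bochner_Integration.integral_sum[OF int_gen]) simp
  finally show ?thesis .
qed

lemma power_gen_4_le:
  assumes R: "R \<ge> 1" and \<theta>: "\<theta> > 0"
  shows "power_gen R 4 (trunc_q R y) x \<le> ((trunc_q R x - trunc_q R y)^4 / \<theta>
    + \<theta> * (3 * (drift_bound A B g)^2 * (1 + q x^4 + q y^4))) / 2"
proof -
  have "\<bar>trunc_q R x - trunc_q R y\<bar> \<le> q x + q y"
    using trunc_q_bounds[of R x] trunc_q_bounds[of R y] q_nonneg[of x] q_nonneg[of y] R by linarith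
  from power4_drift_le[OF this trunc_coefficients_le[OF R] q_nonneg q_nonneg _ _ _ \<theta>]
  show ?thesis
    using constants by (simp add: power_gen_def drift_bound_def)
qed

lemma expectation_power_gen_4_le:
  assumes R: "R \<ge> 1" and \<theta>: "\<theta> > 0" and s: "0 \<le> s" and r: "0 \<le> r"
    and K: "expectation (\<lambda>\<omega>. (trunc_q R (\<omega> r) - trunc_q R (\<omega> s))^4) \<le> K"
  shows "expectation (\<lambda>\<omega>. power_gen R 4 (trunc_q R (\<omega> s)) (\<omega> r))
    \<le> (K / \<theta> + \<theta> * drift_sq_bound A B \<gamma> g) / 2"
proof -
  have R0: "R > 0" using R by simp
  let ?h = "3 * (drift_bound A B g)^2"
  let ?U = "\<lambda>\<omega>. ((trunc_q R (\<omega> r) - trunc_q R (\<omega> s))^4 / \<theta> + \<theta> * (?h * (1 + q (\<omega> r)^4 + q (\<omega> s)^4))) / 2"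
  note int = integrable_trunc_increment[OF R0, of r s 4]
    integrable_moment[OF r, of 4] integrable_moment[OF s, of 4]
  have "0 \<le> ?U \<omega>" for \<omega> using \<theta> by simp
  then have "expectation (\<lambda>\<omega>. power_gen R 4 (trunc_q R (\<omega> s)) (\<omega> r)) \<le> expectation ?U"
    using int by (intro integral_mono' power_gen_4_le[OF R \<theta>]) auto
  also have "\<dots> = (expectation (\<lambda>\<omega>. (trunc_q R (\<omega> r) - trunc_q R (\<omega> s))^4) / \<theta>
      + \<theta> * (?h * (1 + expectation (\<lambda>\<omega>. q (\<omega> r)^4) + expectation (\<lambda>\<omega>. q (\<omega> s)^4)))) / 2"
    using int by simp
  also have "\<dots> \<le> (K / \<theta> + \<theta> * (?h * (1 + 2 * moment_bound A \<gamma> g 4))) / 2"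
    using K \<theta> moment_le[OF r, of 4] moment_le[OF s, of 4]
    by (intro divide_right_mono add_mono[of "_ / \<theta>"] mult_left_mono) auto
  finally show ?thesis by (simp add: drift_sq_bound_def)
qed

lemma trunc_increment_bootstrap:
  assumes R: "R \<ge> 1" and st: "0 \<le> s" "s \<le> t" and \<theta>: "\<theta> > 0" and K: "0 \<le> K"
    and prior: "\<And>r. s \<le> r \<Longrightarrow> r \<le> t \<Longrightarrow> expectation (\<lambda>\<omega>. (trunc_q R (\<omega> r) - trunc_q R (\<omega> s))^4) \<le> K"
  shows "expectation (\<lambda>\<omega>. (trunc_q R (\<omega> t) - trunc_q R (\<omega> s))^4)
    \<le> (t - s) * ((K / \<theta> + \<theta> * drift_sq_bound A B \<gamma> g) / 2)"
proof -
  let ?c = "(K / \<theta> + \<theta> * drift_sq_bound A B \<gamma> g) / 2"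
  have "expectation (\<lambda>\<omega>. (trunc_q R (\<omega> t) - trunc_q R (\<omega> s))^4)
      = (LINT r:{s..t}|lborel. expectation (\<lambda>\<omega>. power_gen R 4 (trunc_q R (\<omega> s)) (\<omega> r)))"
    by (rule expectation_trunc_increment_power[OF R st]) simp
  also have "\<dots> \<le> (LINT r:{s..t}|lborel. ?c)"
    unfolding set_lebesgue_integral_def
  proof (rule integral_mono')
    show "integrable lborel (\<lambda>r. indicat_real {s..t} r *\<^sub>R ?c)"
      by (intro integrable_scaleR_left integrable_real_indicator) (auto simp: emeasure_lborel_Icc_eq)
    have "0 \<le> ?c" using K \<theta> drift_sq_bound_nonneg[of A \<gamma> g B] constants by simp
    then show "0 \<le> indicat_real {s..t} r *\<^sub>R ?c" for r by simp
    show "indicat_real {s..t} r *\<^sub>R expectation (\<lambda>\<omega>. power_gen R 4 (trunc_q R (\<omega> s)) (\<omega> r))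
        \<le> indicat_real {s..t} r *\<^sub>R ?c" for r
      using expectation_power_gen_4_le[OF R \<theta> st(1) _ prior, of r] st by (auto simp: indicator_def)
  qed
  also have "\<dots> = (t - s) * ?c"
    using st by (simp add: set_lebesgue_integral_def)
  finally show ?thesis .
qed

lemma trunc_increment_le_moments:
  assumes R: "R \<ge> 1" and s: "0 \<le> s" and r: "0 \<le> r"
  shows "expectation (\<lambda>\<omega>. (trunc_q R (\<omega> r) - trunc_q R (\<omega> s))^4) \<le> 2 * moment_bound A \<gamma> g 4"
proof -
  have "(trunc_q R x - trunc_q R y)^4 \<le> q x^4 + q y^4" for x y
  proof -
    have "\<bar>trunc_q R x - trunc_q R y\<bar> \<le> max (q x) (q y)"
      using trunc_q_bounds[of R x] trunc_q_bounds[of R y] R by linarith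
    then have "\<bar>trunc_q R x - trunc_q R y\<bar>^4 \<le> (max (q x) (q y))^4" by (intro power_mono) auto
    also have "\<dots> \<le> q x^4 + q y^4" by (simp add: max_def)
    finally show ?thesis by (simp add: power_even_abs_numeral)
  qed
  then have "expectation (\<lambda>\<omega>. (trunc_q R (\<omega> r) - trunc_q R (\<omega> s))^4)
      \<le> expectation (\<lambda>\<omega>. q (\<omega> r)^4 + q (\<omega> s)^4)"
    using integrable_moment[OF r, of 4] integrable_moment[OF s, of 4] by (intro integral_mono') auto
  also have "\<dots> \<le> 2 * moment_bound A \<gamma> g 4"
    using integrable_moment[OF r, of 4] integrable_moment[OF s, of 4]
      moment_le[OF r, of 4] moment_le[OF s, of 4]
    by simp
  finally show ?thesis .
qed

text \<open>Young's inequality with \<open>\<theta> = 1\<close> turns the moment bound into a bound linear in \<open>t - s\<close>; feeding that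
  back with \<open>\<theta> = sqrt (t - s)\<close> yields the exponent 3/2.\<close>
lemma trunc_increment_le:
  assumes R: "R \<ge> 1" and st: "0 \<le> s" "s < t"
  shows "expectation (\<lambda>\<omega>. (trunc_q R (\<omega> t) - trunc_q R (\<omega> s))^4)
    \<le> increment_bound A B \<gamma> g * ((t - s) * sqrt (t - s))"
proof -
  let ?E = "\<lambda>r. expectation (\<lambda>\<omega>. (trunc_q R (\<omega> r) - trunc_q R (\<omega> s))^4)"
  define K where "K = drift_sq_bound A B \<gamma> g"
  define c where "c = (2 * moment_bound A \<gamma> g 4 + K) / 2"
  have "0 \<le> moment_bound A \<gamma> g 4" "0 \<le> K"
    unfolding K_def using constants by (auto intro: moment_bound_nonneg drift_sq_bound_nonneg)
  then have nonneg: "0 \<le> 2 * moment_bound A \<gamma> g 4" "0 \<le> c" by (auto simp: c_def)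
  have linear: "?E r \<le> (t - s) * c" if r: "s \<le> r" "r \<le> t" for r
  proof -
    have "?E r \<le> (r - s) * ((2 * moment_bound A \<gamma> g 4 / 1 + 1 * drift_sq_bound A B \<gamma> g) / 2)"
      using st r by (intro trunc_increment_bootstrap[OF R st(1) r(1) _ nonneg(1)]
          trunc_increment_le_moments[OF R]) auto
    also have "\<dots> = (r - s) * c" by (simp add: c_def K_def)
    also have "\<dots> \<le> (t - s) * c" using r nonneg by (intro mult_right_mono) auto
    finally show ?thesis .
  qed
  have "?E t \<le> (t - s) * (((t - s) * c / sqrt (t - s) + sqrt (t - s) * drift_sq_bound A B \<gamma> g) / 2)"
    using st nonneg linear by (intro trunc_increment_bootstrap[OF R]) auto
  also have "(t - s) * c / sqrt (t - s) = sqrt (t - s) * c"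
    using st real_div_sqrt[of "t - s"] by (metis diff_ge_0_iff_ge less_imp_le times_divide_eq_left)
  finally show ?thesis by (simp add: increment_bound_def c_def K_def field_simps)
qed

theorem
  assumes st: "0 \<le> s" "s < t"
  shows integrable_increment: "integrable P (\<lambda>\<omega>. (q (\<omega> t) - q (\<omega> s))^4)"
    and increment_le: "expectation (\<lambda>\<omega>. (q (\<omega> t) - q (\<omega> s))^4)
      \<le> increment_bound A B \<gamma> g * ((t - s) * sqrt (t - s))"
proof -
  let ?f = "\<lambda>j \<omega>. (trunc_q (real (Suc j)) (\<omega> t) - trunc_q (real (Suc j)) (\<omega> s))^4"
  have int: "integrable P (?f j)" for j by (rule integrable_trunc_increment) simp
  have expectation_le: "expectation (?f j) \<le> increment_bound A B \<gamma> g * ((t - s) * sqrt (t - s))" for j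
    by (rule trunc_increment_le[OF _ st]) simp
  have lim: "(\<lambda>j. ?f j \<omega>) \<longlonglongrightarrow> (q (\<omega> t) - q (\<omega> s))^4" for \<omega>
    unfolding trunc_q_def by (intro tendsto_intros trunc_id_tendsto q_nonneg)
  have nonneg: "0 \<le> ?f j \<omega>" for j \<omega> by (rule zero_le_even_power) simp
  show "integrable P (\<lambda>\<omega>. (q (\<omega> t) - q (\<omega> s))^4)"
    "expectation (\<lambda>\<omega>. (q (\<omega> t) - q (\<omega> s))^4) \<le> increment_bound A B \<gamma> g * ((t - s) * sqrt (t - s))"
    using Fatou_integral_bound[where M = P and f = ?f and g = "\<lambda>\<omega>. (q (\<omega> t) - q (\<omega> s))^4"]
      int nonneg lim expectation_le by blast+
qed

end

section \<open>The generator on functions of a quadratic form\<close>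

definition quad_form :: "nat \<Rightarrow> (nat \<Rightarrow> real) \<Rightarrow> (nat \<Rightarrow> real) \<Rightarrow> real" where
  "quad_form n c x = (\<Sum>l\<in>{1..2*n}. c l * (x l)^2)"

definition quad_drift :: "nat \<Rightarrow> (nat \<Rightarrow> real) \<Rightarrow> real \<Rightarrow>
    (nat \<Rightarrow> real) \<Rightarrow> (nat \<Rightarrow> real) \<Rightarrow> (nat \<Rightarrow> real) \<Rightarrow> real" where
  "quad_drift n lam a \<delta> c x = (\<Sum>l\<in>{1..2*n}. lam l * (a * (1 + \<delta> l) * c l - 2 * c l * (x l)^2))"

definition quad_diff :: "nat \<Rightarrow> (nat \<Rightarrow> real) \<Rightarrow> real \<Rightarrow>
    (nat \<Rightarrow> real) \<Rightarrow> (nat \<Rightarrow> real) \<Rightarrow> (nat \<Rightarrow> real) \<Rightarrow> real" where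
  "quad_diff n lam a \<delta> c x = (\<Sum>l\<in>{1..2*n}. 2 * a * lam l * (1 + \<delta> l) * (c l)^2 * (x l)^2)"

lemma continuous_on_quad:
  "continuous_on S (quad_form n c)" "continuous_on S (quad_drift n lam a \<delta> c)"
  "continuous_on S (quad_diff n lam a \<delta> c)"
  unfolding quad_form_def[abs_def] quad_drift_def[abs_def] quad_diff_def[abs_def]
  by (intro continuous_intros)+

lemma quad_form_fun_upd:
  assumes "l \<in> {1..2*n}"
  shows "quad_form n c (x(l := y)) = quad_form n c x + c l * (y^2 - (x l)^2)"
proof -
  have "quad_form n c z = c l * (z l)^2 + (\<Sum>k\<in>{1..2*n} - {l}. c k * (z k)^2)" for z
    unfolding quad_form_def using assms by (subst sum.remove[of _ l]) auto
  then show ?thesis by (simp add: algebra_simps)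
qed

lemma pd_eqI:
  assumes "((\<lambda>t. f (x(l := x l + t))) has_real_derivative D) (at 0)"
  shows "pd l f x = D" "has_pd l f x"
  using assms unfolding pd_def has_pd_def
  by (auto intro: DERIV_imp_deriv simp: real_differentiable_def)

lemma DERIV_compose_quad_form:
  assumes "l \<in> {1..2*n}" and "(\<phi> has_real_derivative \<phi>') (at (quad_form n c x))"
  shows "((\<lambda>t. \<phi> (quad_form n c (x(l := x l + t)))) has_real_derivative \<phi>' * (2 * c l * x l)) (at 0)"
proof -
  have "((\<lambda>t. quad_form n c x + c l * ((x l + t)^2 - (x l)^2)) has_real_derivative 2 * c l * x l) (at 0)"
    by (auto intro!: derivative_eq_intros)
  from DERIV_chain2[OF _ this, of \<phi> \<phi>'] show ?thesis
    using assms by (simp add: quad_form_fun_upd)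
qed

lemma
  assumes \<phi>: "has_C2_derivs \<phi> \<phi>' \<phi>''" and l: "l \<in> {1..2*n}"
  shows pd_compose_quad_form: "pd l (\<lambda>x. \<phi> (quad_form n c x))
      = (\<lambda>x. \<phi>' (quad_form n c x) * (2 * c l * x l))"
    and has_pd_compose_quad_form: "has_pd l (\<lambda>x. \<phi> (quad_form n c x)) x"
proof -
  have "((\<lambda>t. \<phi> (quad_form n c (x(l := x l + t)))) has_real_derivative
      \<phi>' (quad_form n c x) * (2 * c l * x l)) (at 0)" for x
    using \<phi> by (intro DERIV_compose_quad_form[OF l]) (simp add: has_C2_derivs_def)
  note pd = pd_eqI[OF this]
  show "pd l (\<lambda>x. \<phi> (quad_form n c x)) = (\<lambda>x. \<phi>' (quad_form n c x) * (2 * c l * x l))"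
    using pd(1) by auto
  show "has_pd l (\<lambda>x. \<phi> (quad_form n c x)) x" by (rule pd(2))
qed

lemma
  assumes \<phi>: "has_C2_derivs \<phi> \<phi>' \<phi>''" and l: "l \<in> {1..2*n}" and m: "m \<in> {1..2*n}"
  shows pd_pd_compose_quad_form: "pd m (pd l (\<lambda>x. \<phi> (quad_form n c x))) =
      (\<lambda>x. \<phi>'' (quad_form n c x) * (2 * c m * x m) * (2 * c l * x l)
        + \<phi>' (quad_form n c x) * (2 * c l * of_bool (l = m)))"
    and has_pd_pd_compose_quad_form: "has_pd m (pd l (\<lambda>x. \<phi> (quad_form n c x))) x"
proof -
  have deriv: "((\<lambda>t. \<phi>' (quad_form n c (x(m := x m + t))) * (2 * c l * (x(m := x m + t)) l))
        has_real_derivative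
      \<phi>'' (quad_form n c x) * (2 * c m * x m) * (2 * c l * x l)
        + \<phi>' (quad_form n c x) * (2 * c l * of_bool (l = m))) (at 0)" for x
  proof -
    have "((\<lambda>t. \<phi>' (quad_form n c (x(m := x m + t)))) has_real_derivative
        \<phi>'' (quad_form n c x) * (2 * c m * x m)) (at 0)"
      using \<phi> by (intro DERIV_compose_quad_form[OF m]) (simp add: has_C2_derivs_def)
    moreover have "((\<lambda>t. 2 * c l * (x(m := x m + t)) l)
        has_real_derivative 2 * c l * of_bool (l = m)) (at 0)"
      by (cases "l = m") (auto intro!: derivative_eq_intros)
    ultimately show ?thesis
      by (rule DERIV_cong[OF DERIV_mult]) (simp add: algebra_simps)
  qed
  note pd = pd_eqI[of "\<lambda>x. \<phi>' (quad_form n c x) * (2 * c l * x l)", OF deriv]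
  show "pd m (pd l (\<lambda>x. \<phi> (quad_form n c x))) =
      (\<lambda>x. \<phi>'' (quad_form n c x) * (2 * c m * x m) * (2 * c l * x l)
        + \<phi>' (quad_form n c x) * (2 * c l * of_bool (l = m)))"
    unfolding pd_compose_quad_form[OF \<phi> l] using pd(1) by auto
  show "has_pd m (pd l (\<lambda>x. \<phi> (quad_form n c x))) x"
    unfolding pd_compose_quad_form[OF \<phi> l] by (rule pd(2))
qed

lemma vf_compose_quad_form:
  assumes "has_C2_derivs \<phi> \<phi>' \<phi>''"
  shows "vf n d (\<lambda>x. \<phi> (quad_form n c x)) x
      = \<phi>' (quad_form n c x) * (\<Sum>l\<in>{1..2*n}. d x l * (2 * c l * x l))"
  unfolding vf_def sum_distrib_left
  by (intro sum.cong) (auto simp: pd_compose_quad_form[OF assms])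

lemma Rfield_tangent:
  assumes "i \<in> {1..n}" "c (2*i - 1) = c (2*i)"
  shows "(\<Sum>l\<in>{1..2*n}. Rfield i x l * (2 * c l * x l)) = 0"
proof -
  have "(\<Sum>l\<in>{1..2*n}. Rfield i x l * (2 * c l * x l)) = (\<Sum>l\<in>{2*i-1, 2*i}. Rfield i x l * (2 * c l * x l))"
    using assms(1) by (intro sum.mono_neutral_right) (auto simp: Rfield_def)
  also have "\<dots> = 0"
    using assms by (subst sum.insert) (auto simp: Rfield_def)
  finally show ?thesis .
qed

text \<open>With \<open>c = \<alpha> + \<beta> / \<lambda>\<close>, the cyclic sum of \<open>c\<^sub>k (1 / \<lambda>\<^sub>i - 1 / \<lambda>\<^sub>j)\<close> vanishes: this is what singles out
  the span of the two conserved forms.\<close>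
lemma Tfield_tangent:
  assumes J: "J \<in> Jset n lam" and c: "\<And>l. l \<in> {1..2*n} \<Longrightarrow> c l = \<alpha> + \<beta> * (1 / lam l)"
  shows "(\<Sum>l\<in>{1..2*n}. Tfield lam J x l * (2 * c l * x l)) = 0"
proof -
  obtain i j k where J_eq: "J = (i,j,k)" and ijk: "i \<in> {1..2*n}" "j \<in> {1..2*n}" "k \<in> {1..2*n}"
    using J by (auto simp: Jset_def)
  have cyc: "(\<Sum>l\<in>{1..2*n}. cyc_term lam p q s x l * (2 * c l * x l))
      = x p * x q * (1 / lam p - 1 / lam q) * (2 * c s * x s)" if "s \<in> {1..2*n}" for p q s
  proof -
    have "(\<Sum>l\<in>{1..2*n}. cyc_term lam p q s x l * (2 * c l * x l)) =
       (\<Sum>l\<in>{1..2*n}. if l = s then x p * x q * (1 / lam p - 1 / lam q) * (2 * c s * x s) else 0)"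
      by (intro sum.cong) (auto simp: cyc_term_def)
    then show ?thesis using that by (simp add: sum.delta)
  qed
  have "(\<Sum>l\<in>{1..2*n}. Tfield lam J x l * (2 * c l * x l)) = x i * x j * x k * 2 *
      (c k * (1 / lam i - 1 / lam j) + c i * (1 / lam j - 1 / lam k) + c j * (1 / lam k - 1 / lam i))"
    unfolding J_eq Tfield_def prod.case distrib_right sum.distrib
      cyc[OF ijk(1)] cyc[OF ijk(2)] cyc[OF ijk(3)]
    by (simp add: algebra_simps)
  also have "c k * (1 / lam i - 1 / lam j) + c i * (1 / lam j - 1 / lam k)
      + c j * (1 / lam k - 1 / lam i) = 0"
    unfolding c[OF ijk(1)] c[OF ijk(2)] c[OF ijk(3)] by algebra
  finally show ?thesis by simp
qed

lemma Ltilde_compose_quad_form: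
  assumes \<phi>: "has_C2_derivs \<phi> \<phi>' \<phi>''"
  shows "Ltilde n lam a \<delta> (\<lambda>x. \<phi> (quad_form n c x)) x =
    \<phi>' (quad_form n c x) * quad_drift n lam a \<delta> c x + \<phi>'' (quad_form n c x) * quad_diff n lam a \<delta> c x"
  unfolding Ltilde_def quad_drift_def quad_diff_def sum_distrib_left sum.distrib[symmetric]
proof (intro sum.cong refl)
  fix l assume l: "l \<in> {1..2*n}"
  show "lam l * (a / 2 * (1 + \<delta> l) * pd l (pd l (\<lambda>x. \<phi> (quad_form n c x))) x
      - x l * pd l (\<lambda>x. \<phi> (quad_form n c x)) x) =
    \<phi>' (quad_form n c x) * (lam l * (a * (1 + \<delta> l) * c l - 2 * c l * (x l)^2)) +
    \<phi>'' (quad_form n c x) * (2 * a * lam l * (1 + \<delta> l) * (c l)^2 * (x l)^2)"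
    unfolding fun_cong[OF pd_compose_quad_form[OF \<phi> l]] fun_cong[OF pd_pd_compose_quad_form[OF \<phi> l l]]
    by (simp add: power2_eq_square field_simps)
qed

lemma Lgen_compose_quad_form:
  assumes \<phi>: "has_C2_derivs \<phi> \<phi>' \<phi>''"
    and c: "\<And>l. l \<in> {1..2*n} \<Longrightarrow> c l = \<alpha> + \<beta> * (1 / lam l)"
    and lam_pair: "\<forall>i\<in>{1..n}. lam (2*i - 1) = lam (2*i)"
    and b_orth: "inner0 n x (b x) = 0" "inner_m1 n lam x (b x) = 0"
  shows "Lgen n lam a \<delta> b \<kappa> \<epsilon> (\<lambda>x. \<phi> (quad_form n c x)) x =
    \<phi>' (quad_form n c x) * quad_drift n lam a \<delta> c x + \<phi>'' (quad_form n c x) * quad_diff n lam a \<delta> c x"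
proof -
  have "(\<Sum>l\<in>{1..2*n}. b x l * (2 * c l * x l)) = 2 * (\<alpha> * inner0 n x (b x) + \<beta> * inner_m1 n lam x (b x))"
    unfolding inner0_def inner_m1_def sum_distrib_left sum.distrib[symmetric]
    by (intro sum.cong refl) (simp add: c algebra_simps)
  then have b_zero: "vf n b (\<lambda>x. \<phi> (quad_form n c x)) x = 0"
    using b_orth by (simp add: vf_compose_quad_form[OF \<phi>])
  have T_zero: "vf n (Tfield lam J) (\<lambda>x. \<phi> (quad_form n c x)) = (\<lambda>x. 0)" if "J \<in> Jset n lam" for J
    using Tfield_tangent[OF that c] by (auto simp: vf_compose_quad_form[OF \<phi>])
  have R_zero: "vf n (Rfield i) (\<lambda>x. \<phi> (quad_form n c x)) = (\<lambda>x. 0)" if i: "i \<in> {1..n}" for i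
  proof -
    have "c (2*i - 1) = c (2*i)" using i lam_pair by (subst (1 2) c) auto
    from Rfield_tangent[where c = c, OF i this] show ?thesis by (auto simp: vf_compose_quad_form[OF \<phi>])
  qed
  have "vf n d (\<lambda>x. 0) x = 0" for d by (simp add: vf_def pd_def)
  then have "Dop n lam (\<lambda>x. \<phi> (quad_form n c x)) x = 0"
    unfolding Dop_def by (simp add: T_zero R_zero)
  then show ?thesis
    by (simp add: Lgen_def b_zero Ltilde_compose_quad_form[OF \<phi>])
qed

lemma testfun_compose_quad_form:
  assumes \<phi>: "has_C2_derivs \<phi> \<phi>' \<phi>''" and supp: "\<And>s. s \<ge> R \<Longrightarrow> \<phi> s = 0"
    and c: "\<And>l. l \<in> {1..2*n} \<Longrightarrow> 0 < c l"
  shows "testfun n (\<lambda>x. \<phi> (quad_form n c x))"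
proof -
  have cont: "continuous_on S (\<lambda>x. \<psi> (quad_form n c x))"
    if "continuous_on UNIV \<psi>" for S and \<psi> :: "real \<Rightarrow> real"
    by (rule continuous_on_compose2[OF that continuous_on_quad(1)]) simp
  note cont_\<phi> = has_C2_derivs_continuous[OF \<phi>, THEN cont]
  define c0 where "c0 = Min (insert 1 (c ` {1..2*n}))"
  have c0: "0 < c0" "\<And>l. l \<in> {1..2*n} \<Longrightarrow> c0 \<le> c l"
    unfolding c0_def using c by (auto intro!: Min_le simp del: Min_insert)
  have "\<phi> (quad_form n c x) = 0" if "sqnorm n x > R / c0" for x
  proof (rule supp)
    have "R \<le> c0 * sqnorm n x" using that c0(1) by (simp add: field_simps)
    also have "\<dots> \<le> quad_form n c x"
      unfolding sqnorm_def quad_form_def sum_distrib_left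
      by (intro sum_mono mult_right_mono c0(2)) auto
    finally show "R \<le> quad_form n c x" .
  qed
  moreover have "continuous_on (Estate n) (pd l (\<lambda>x. \<phi> (quad_form n c x)))" if "l \<in> {1..2*n}" for l
    unfolding pd_compose_quad_form[OF \<phi> that] by (intro cont_\<phi> continuous_intros)
  moreover have "continuous_on (Estate n) (pd m (pd l (\<lambda>x. \<phi> (quad_form n c x))))"
    if "l \<in> {1..2*n}" "m \<in> {1..2*n}" for l m
    unfolding pd_pd_compose_quad_form[OF \<phi> that] by (intro cont_\<phi> continuous_intros)
  ultimately show ?thesis
    unfolding testfun_def
    using has_pd_compose_quad_form[OF \<phi>] has_pd_pd_compose_quad_form[OF \<phi>] cont_\<phi>(1) by blast
qed

locale weighted_form =
  fixes n :: nat and lam \<delta> c :: "nat \<Rightarrow> real" and a \<Lambda> :: real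
  assumes lam: "\<And>l. l \<in> {1..2*n} \<Longrightarrow> 1 \<le> lam l \<and> lam l \<le> \<Lambda>"
    and \<delta>: "\<And>l. l \<in> {1..2*n} \<Longrightarrow> -1 \<le> \<delta> l \<and> \<delta> l \<le> 0"
    and c: "\<And>l. l \<in> {1..2*n} \<Longrightarrow> 0 < c l \<and> c l \<le> 1"
    and a_nonneg: "0 \<le> a" and \<Lambda>_nonneg: "0 \<le> \<Lambda>"
begin

lemma quad_form_nonneg: "0 \<le> quad_form n c x"
  unfolding quad_form_def using c by (intro sum_nonneg mult_nonneg_nonneg less_imp_le[of 0 "c _"]) auto

lemma lam_sum_bounds:
  "quad_form n c x \<le> (\<Sum>l\<in>{1..2*n}. lam l * (c l * (x l)^2))"
  "(\<Sum>l\<in>{1..2*n}. lam l * (c l * (x l)^2)) \<le> \<Lambda> * quad_form n c x"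
proof -
  have summand: "c l * (x l)^2 \<le> lam l * (c l * (x l)^2) \<and> lam l * (c l * (x l)^2) \<le> \<Lambda> * (c l * (x l)^2)"
    if l: "l \<in> {1..2*n}" for l
  proof -
    have "0 \<le> c l * (x l)^2" using c[OF l] by simp
    then show ?thesis
      using lam[OF l] mult_right_mono[of 1 "lam l" "c l * (x l)^2"]
        mult_right_mono[of "lam l" \<Lambda> "c l * (x l)^2"]
      by simp
  qed
  show "quad_form n c x \<le> (\<Sum>l\<in>{1..2*n}. lam l * (c l * (x l)^2))"
    unfolding quad_form_def using summand by (intro sum_mono) simp
  show "(\<Sum>l\<in>{1..2*n}. lam l * (c l * (x l)^2)) \<le> \<Lambda> * quad_form n c x"
    unfolding quad_form_def sum_distrib_left using summand by (intro sum_mono) simp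
qed

lemma lam_noise_bounds:
  assumes l: "l \<in> {1..2*n}"
  shows "0 \<le> lam l * (1 + \<delta> l) * c l" "lam l * (1 + \<delta> l) * c l \<le> \<Lambda>"
proof -
  show "0 \<le> lam l * (1 + \<delta> l) * c l"
    using lam[OF l] \<delta>[OF l] c[OF l] by (intro mult_nonneg_nonneg) auto
  have "lam l * (1 + \<delta> l) * c l \<le> \<Lambda> * 1 * 1"
    using lam[OF l] \<delta>[OF l] c[OF l] \<Lambda>_nonneg by (intro mult_mono) auto
  then show "lam l * (1 + \<delta> l) * c l \<le> \<Lambda>" by simp
qed

lemma quad_drift_bounds:
  "quad_drift n lam a \<delta> c x \<le> real (2 * n) * a * \<Lambda> - 2 * quad_form n c x"
  "\<bar>quad_drift n lam a \<delta> c x\<bar> \<le> real (2 * n) * a * \<Lambda> + 2 * \<Lambda> * quad_form n c x"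
proof -
  define A where "A = (\<Sum>l\<in>{1..2*n}. a * (lam l * (1 + \<delta> l) * c l))"
  have "0 \<le> A" unfolding A_def
    by (intro sum_nonneg mult_nonneg_nonneg[OF a_nonneg] lam_noise_bounds(1))
  moreover have "A \<le> (\<Sum>l\<in>{1..2*n}. a * \<Lambda>)" unfolding A_def
    using lam_noise_bounds(2) a_nonneg by (intro sum_mono mult_left_mono) auto
  moreover have "quad_drift n lam a \<delta> c x = A - 2 * (\<Sum>l\<in>{1..2*n}. lam l * (c l * (x l)^2))"
    unfolding quad_drift_def A_def sum_distrib_left sum_subtractf[symmetric]
    by (intro sum.cong) (auto simp: algebra_simps)
  ultimately show "quad_drift n lam a \<delta> c x \<le> real (2 * n) * a * \<Lambda> - 2 * quad_form n c x"
    "\<bar>quad_drift n lam a \<delta> c x\<bar> \<le> real (2 * n) * a * \<Lambda> + 2 * \<Lambda> * quad_form n c x"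
    using lam_sum_bounds[of x] quad_form_nonneg[of x] by (simp_all add: abs_le_iff)
qed

lemma quad_diff_bounds:
  "0 \<le> quad_diff n lam a \<delta> c x" "quad_diff n lam a \<delta> c x \<le> 2 * a * \<Lambda> * quad_form n c x"
proof -
  have diff_eq: "quad_diff n lam a \<delta> c x = (\<Sum>l\<in>{1..2*n}. (2 * a * (c l * (x l)^2)) * (lam l * (1 + \<delta> l) * c l))"
    unfolding quad_diff_def by (intro sum.cong refl) (simp add: power2_eq_square algebra_simps)
  have weight: "0 \<le> 2 * a * (c l * (x l)^2)" if "l \<in> {1..2*n}" for l
    using c[OF that] a_nonneg by simp
  show "0 \<le> quad_diff n lam a \<delta> c x"
    unfolding diff_eq by (intro sum_nonneg mult_nonneg_nonneg weight lam_noise_bounds(1))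
  have "quad_diff n lam a \<delta> c x \<le> (\<Sum>l\<in>{1..2*n}. (2 * a * (c l * (x l)^2)) * \<Lambda>)"
    unfolding diff_eq by (intro sum_mono mult_left_mono weight lam_noise_bounds(2))
  also have "\<dots> = 2 * a * \<Lambda> * quad_form n c x"
    unfolding quad_form_def sum_distrib_left by (intro sum.cong refl) (simp add: mult_ac)
  finally show "quad_diff n lam a \<delta> c x \<le> 2 * a * \<Lambda> * quad_form n c x" .
qed

lemma dissipative_functional_quad_form:
  assumes c_span: "\<And>l. l \<in> {1..2*n} \<Longrightarrow> c l = \<alpha> + \<beta> * (1 / lam l)"
    and lam_pair: "\<forall>i\<in>{1..n}. lam (2*i - 1) = lam (2*i)"
    and b_orth: "\<forall>x\<in>Estate n. inner0 n x (b x) = 0" "\<forall>x\<in>Estate n. inner_m1 n lam x (b x) = 0"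
    and sol: "stationary_solution n (Lgen n lam a \<delta> b \<kappa> \<epsilon>) P"
  shows "dissipative_functional n (Lgen n lam a \<delta> b \<kappa> \<epsilon>) P (quad_form n c)
    (quad_drift n lam a \<delta> c) (quad_diff n lam a \<delta> c) (real (2 * n) * a * \<Lambda>) (2 * \<Lambda>) 2 (2 * a * \<Lambda>)"
proof -
  interpret stationary_MP_solution n "Lgen n lam a \<delta> b \<kappa> \<epsilon>" P
    using sol by (simp add: stationary_solution_iff)
  show ?thesis
  proof
    show "testfun n (\<lambda>x. \<phi> (quad_form n c x))"
      if "has_C2_derivs \<phi> \<phi>' \<phi>''" "\<And>s. s \<ge> R \<Longrightarrow> \<phi> s = 0" for \<phi> \<phi>' \<phi>'' R
      using that c by (intro testfun_compose_quad_form) auto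
    show "Lgen n lam a \<delta> b \<kappa> \<epsilon> (\<lambda>x. \<phi> (quad_form n c x)) x =
        \<phi>' (quad_form n c x) * quad_drift n lam a \<delta> c x + \<phi>'' (quad_form n c x) * quad_diff n lam a \<delta> c x"
      if "has_C2_derivs \<phi> \<phi>' \<phi>''" "x \<in> Estate n" for \<phi> \<phi>' \<phi>'' x
      using b_orth that(2) by (intro Lgen_compose_quad_form[OF that(1) c_span lam_pair]) auto
  qed (use a_nonneg \<Lambda>_nonneg in \<open>auto intro: continuous_on_quad quad_form_nonneg
      quad_drift_bounds[simplified] quad_diff_bounds\<close>)
qed

end

section \<open>Tightness of the pair of quadratic forms\<close>

lemma dist_Pair_power4_le: "dist (u, v) (u', v')^4 \<le> 2 * ((u - u')^4 + (v - v')^4)" for u v u' v' :: real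
proof -
  have "dist (u, v) (u', v')^4 = ((dist (u, v) (u', v'))^2)^2" by simp
  also have "\<dots> = ((u - u')^2 + (v - v')^2)^2"
    by (simp add: dist_Pair_Pair dist_real_def)
  also have "\<dots> \<le> 2 * ((u - u')^4 + (v - v')^4)"
  proof -
    have "0 \<le> ((u - u')^2 - (v - v')^2)^2" by simp
    then show ?thesis by (simp add: power2_sum power2_diff[of "_^2"] flip: power_mult)
  qed
  finally show ?thesis .
qed

locale dissipative_pair =
  U: dissipative_functional n L P u D G A B \<gamma> g + V: dissipative_functional n L P v D' G' A B \<gamma> g
  for n L P u D G v D' G' A B \<gamma> g
begin

lemma initial_tail_le:
  assumes "0 < K"
  shows "measure P {\<omega> \<in> space P. norm (u (\<omega> 0), v (\<omega> 0)) > K} \<le> 2 * moment_bound A \<gamma> g 1 / K"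
proof -
  note int = U.integrable_moment[of 0 1, simplified] V.integrable_moment[of 0 1, simplified]
  have norm_le: "norm (u x, v x) \<le> u x + v x" for x
    using norm_Pair_le[of "u x" "v x"] U.q_nonneg[of x] V.q_nonneg[of x] by simp
  have [measurable]: "(\<lambda>\<omega>. u (\<omega> 0) + v (\<omega> 0)) \<in> borel_measurable P"
    using int by auto
  have "measure P {\<omega> \<in> space P. norm (u (\<omega> 0), v (\<omega> 0)) > K}
      \<le> measure P {\<omega> \<in> space P. u (\<omega> 0) + v (\<omega> 0) \<ge> K}"
  proof (rule U.finite_measure_mono)
    show "{\<omega> \<in> space P. u (\<omega> 0) + v (\<omega> 0) \<ge> K} \<in> U.events" by measurable
  qed (use norm_le in \<open>auto intro: order_trans less_imp_le\<close>)
  also have "\<dots> \<le> (\<integral>\<omega>. u (\<omega> 0) + v (\<omega> 0) \<partial>P) / K"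
    using int assms U.q_nonneg V.q_nonneg
    by (intro integral_Markov_inequality_measure[where A = "{}"]) auto
  also have "\<dots> \<le> 2 * moment_bound A \<gamma> g 1 / K"
    using int assms U.moment_le[of 0 1] V.moment_le[of 0 1] by (intro divide_right_mono) auto
  finally show ?thesis .
qed

lemma initial_tight:
  assumes "\<eta> > 0"
  shows "measure P {\<omega> \<in> space P. norm (u (\<omega> 0), v (\<omega> 0)) > 2 * moment_bound A \<gamma> g 1 / \<eta> + 1} \<le> \<eta>"
proof -
  define m where "m = moment_bound A \<gamma> g 1"
  have m: "0 \<le> m" unfolding m_def using U.constants by (intro moment_bound_nonneg) auto
  with assms have "0 < 2 * m / \<eta> + 1" by (simp add: add_nonneg_pos)
  from initial_tail_le[OF this]
  have "measure P {\<omega> \<in> space P. norm (u (\<omega> 0), v (\<omega> 0)) > 2 * m / \<eta> + 1} \<le> 2 * m / (2 * m / \<eta> + 1)"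
    by (simp add: m_def)
  also have "\<dots> \<le> \<eta>"
    using assms m \<open>0 < 2 * m / \<eta> + 1\<close> by (simp add: pos_divide_le_eq distrib_left)
  finally show ?thesis by (simp add: m_def)
qed

lemma Kolmogorov_increments_pair:
  "Kolmogorov_increments P (\<lambda>t \<omega>. (u (\<omega> t), v (\<omega> t))) 4 (1/2) (4 * increment_bound A B \<gamma> g)"
proof
  note [measurable] = U.borel_measurable_path[OF U.continuous(1)]
    U.borel_measurable_path[OF V.continuous(1)]
  show "(\<lambda>\<omega>. (u (\<omega> t), v (\<omega> t))) \<in> borel_measurable P" for t by measurable
  fix s t :: real assume st: "0 \<le> s" "s < t"
  let ?d = "\<lambda>\<omega>. dist (u (\<omega> t), v (\<omega> t)) (u (\<omega> s), v (\<omega> s)) powr 4"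
  let ?h = "\<lambda>\<omega>. 2 * ((u (\<omega> t) - u (\<omega> s))^4 + (v (\<omega> t) - v (\<omega> s))^4)"
  note int = U.integrable_increment[OF st] V.integrable_increment[OF st]
  have dist_le: "?d \<omega> \<le> ?h \<omega>" for \<omega> using dist_Pair_power4_le by simp
  show int_d: "integrable P ?d"
    by (rule Bochner_Integration.integrable_bound[where f = ?h])
       (use int order_trans[OF dist_le abs_ge_self] in \<open>auto intro!: AE_I2\<close>)
  have "U.expectation ?d \<le> U.expectation ?h"
    using int by (intro integral_mono int_d dist_le) auto
  also have "\<dots> \<le> 4 * increment_bound A B \<gamma> g * ((t - s) * sqrt (t - s))"
    using int U.increment_le[OF st] V.increment_le[OF st] by simp
  also have "(t - s) * sqrt (t - s) = (t - s) powr (1 + 1/2)"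
    using st by (subst powr_add) (simp add: powr_half_sqrt)
  finally show "U.expectation ?d \<le> 4 * increment_bound A B \<gamma> g * (t - s) powr (1 + 1/2)" .
qed simp_all

end

theorem dissipative_pair_tightness:
  assumes S: "closed S"
    and pair: "\<And>i. i \<in> I \<Longrightarrow> dissipative_pair n (L i) (P i) u D G v D' G' A B \<gamma> g"
    and path: "\<And>\<omega>. \<omega> \<in> Paths n \<Longrightarrow> (\<lambda>t. (u (\<omega> t), v (\<omega> t))) \<in> CPaths S"
    and \<eta>: "\<eta> > 0"
  shows "\<exists>K. K \<subseteq> CPaths S \<and> compactin (luc_topology (CPaths S)) K \<and>
    (\<forall>i\<in>I. measure (P i) {\<omega> \<in> space (P i). (\<lambda>t. (u (\<omega> t), v (\<omega> t))) \<in> K} \<ge> 1 - \<eta>)"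
proof (rule Kolmogorov_tightness[OF S _ _ _ _ _ \<eta>])
  show "\<exists>K. \<forall>i\<in>I. measure (P i) {\<omega> \<in> space (P i). norm (u (\<omega> 0), v (\<omega> 0)) > K} \<le> \<zeta>" if "\<zeta> > 0" for \<zeta>
    using dissipative_pair.initial_tight[OF pair that] by blast
  fix i assume "i \<in> I"
  then interpret dissipative_pair n "L i" "P i" u D G v D' G' A B \<gamma> g by (rule pair)
  show "(\<lambda>t. (u (\<omega> t), v (\<omega> t))) \<in> CPaths S" if "\<omega> \<in> space (P i)" for \<omega> using that by (intro path) simp
  show "Kolmogorov_increments (P i) (\<lambda>t \<omega>. (u (\<omega> t), v (\<omega> t))) 4 (1/2) (4 * increment_bound A B \<gamma> g)"
    by (rule Kolmogorov_increments_pair)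
qed simp_all

lemma sqnorm_eq_quad_form: "sqnorm n = quad_form n (\<lambda>_. 1)"
  by (simp add: fun_eq_iff sqnorm_def quad_form_def)

lemma sqnorm_m1_eq_quad_form: "sqnorm_m1 n lam = quad_form n (\<lambda>l. 1 / lam l)"
  by (simp add: fun_eq_iff sqnorm_m1_def quad_form_def)

lemma dissipative_pair_sqnorm:
  assumes lam: "\<And>l. l \<in> {1..2*n} \<Longrightarrow> 1 \<le> lam l \<and> lam l \<le> \<Lambda>" and "0 \<le> \<Lambda>" "0 \<le> a"
    and \<delta>: "\<And>l. l \<in> {1..2*n} \<Longrightarrow> -1 \<le> \<delta> l \<and> \<delta> l \<le> 0"
    and lam_pair: "\<forall>i\<in>{1..n}. lam (2*i - 1) = lam (2*i)"
    and b_orth: "\<forall>x\<in>Estate n. inner0 n x (b x) = 0" "\<forall>x\<in>Estate n. inner_m1 n lam x (b x) = 0"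
    and sol: "stationary_solution n (Lgen n lam a \<delta> b \<kappa> \<epsilon>) P"
  shows "dissipative_pair n (Lgen n lam a \<delta> b \<kappa> \<epsilon>) P
    (sqnorm n) (quad_drift n lam a \<delta> (\<lambda>_. 1)) (quad_diff n lam a \<delta> (\<lambda>_. 1))
    (sqnorm_m1 n lam) (quad_drift n lam a \<delta> (\<lambda>l. 1 / lam l)) (quad_diff n lam a \<delta> (\<lambda>l. 1 / lam l))
    (real (2 * n) * a * \<Lambda>) (2 * \<Lambda>) 2 (2 * a * \<Lambda>)"
  unfolding dissipative_pair_def sqnorm_eq_quad_form sqnorm_m1_eq_quad_form
proof
  interpret U: weighted_form n lam \<delta> "\<lambda>_. 1" a \<Lambda>
    by unfold_locales (use assms in auto)
  show "dissipative_functional n (Lgen n lam a \<delta> b \<kappa> \<epsilon>) P (quad_form n (\<lambda>_. 1))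
      (quad_drift n lam a \<delta> (\<lambda>_. 1)) (quad_diff n lam a \<delta> (\<lambda>_. 1))
      (real (2 * n) * a * \<Lambda>) (2 * \<Lambda>) 2 (2 * a * \<Lambda>)"
    by (rule U.dissipative_functional_quad_form[OF _ lam_pair b_orth sol, of 1 0]) simp
  have "0 < 1 / lam l \<and> 1 / lam l \<le> 1" if "l \<in> {1..2*n}" for l
    using lam[OF that] by simp
  then interpret V: weighted_form n lam \<delta> "\<lambda>l. 1 / lam l" a \<Lambda>
    by unfold_locales (use assms in auto)
  show "dissipative_functional n (Lgen n lam a \<delta> b \<kappa> \<epsilon>) P (quad_form n (\<lambda>l. 1 / lam l))
      (quad_drift n lam a \<delta> (\<lambda>l. 1 / lam l)) (quad_diff n lam a \<delta> (\<lambda>l. 1 / lam l))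
      (real (2 * n) * a * \<Lambda>) (2 * \<Lambda>) 2 (2 * a * \<Lambda>)"
    by (rule V.dissipative_functional_quad_form[OF _ lam_pair b_orth sol, of 0 1]) simp
qed

lemma closed_Cone: "closed (Cone n lam)"
proof -
  have "Cone n lam = {z. 0 \<le> snd z} \<inter> {z. snd z \<le> fst z} \<inter> {z. fst z \<le> lam (2*n) * snd z}"
    by (auto simp: Cone_def)
  also have "closed \<dots>" by (intro closed_Int closed_Collect_le continuous_intros)
  finally show ?thesis .
qed

lemma Wmap_in_Cone:
  assumes "\<forall>l\<in>{1..2*n}. 1 \<le> lam l \<and> lam l \<le> lam (2*n)"
  shows "Wmap n lam x \<in> Cone n lam"
proof -
  have bounds: "0 \<le> (x l)^2 / lam l" "(x l)^2 / lam l \<le> (x l)^2" "(x l)^2 \<le> lam (2*n) * ((x l)^2 / lam l)"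
    if "l \<in> {1..2*n}" for l
    using bspec[OF assms that] mult_right_mono[of 1 "lam l" "(x l)^2"]
      mult_right_mono[of "lam l" "lam (2*n)" "(x l)^2"]
    by (auto simp: field_simps)
  show ?thesis
    unfolding Cone_def Wmap_def sqnorm_def sqnorm_m1_def mem_Collect_eq prod.case
    by (intro conjI sum_nonneg sum_mono ord_le_eq_trans[OF sum_mono sum_distrib_left[symmetric]] bounds)
qed

lemma Wmap_path_in_CPaths:
  assumes "\<forall>l\<in>{1..2*n}. 1 \<le> lam l \<and> lam l \<le> lam (2*n)" and \<omega>: "\<omega> \<in> Paths n"
  shows "(\<lambda>t. Wmap n lam (\<omega> t)) \<in> CPaths (Cone n lam)"
proof -
  have "continuous_on UNIV (\<lambda>t. Wmap n lam (\<omega> t))"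
    unfolding Wmap_def sqnorm_eq_quad_form sqnorm_m1_eq_quad_form
    by (intro continuous_on_Pair continuous_on_Paths_compose[OF \<omega>] continuous_on_quad)
  moreover have "Wmap n lam (\<omega> t) = Wmap n lam (\<omega> 0)" if "t \<le> 0" for t
    by (simp only: PathsD(3)[OF \<omega> that])
  ultimately show ?thesis
    unfolding CPaths_def using Wmap_in_Cone[OF assms(1)] by blast
qed

lemma eigenvalue_bounds:
  fixes lam :: "nat \<Rightarrow> real"
  assumes lam1: "lam 1 = 1"
    and lam_pair: "\<forall>i\<in>{1..n}. lam (2*i - 1) = lam (2*i)"
    and lam_incr: "\<forall>i\<in>{1..<n}. lam (2*i) < lam (2*i + 1)"
    and l: "l \<in> {1..2*n}"
  shows "1 \<le> lam l \<and> lam l \<le> lam (2*n)"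
proof -
  have incr: "lam i \<le> lam (Suc i)" if i: "1 \<le> i" "i < 2*n" for i
  proof (cases "even i")
    case True
    then obtain j where j: "i = 2 * j" by blast
    then have "lam (2*j) < lam (2*j + 1)" using i by (intro lam_incr[rule_format]) auto
    then show ?thesis by (simp add: j)
  next
    case False
    then obtain j where j: "i = 2 * j + 1" by (rule oddE)
    then have "lam (2 * Suc j - 1) = lam (2 * Suc j)" using i by (intro lam_pair[rule_format]) auto
    then show ?thesis by (simp add: j)
  qed
  have mono: "lam i \<le> lam j" if "i \<le> j" "1 \<le> i" "j \<le> 2*n" for i j
    using that(1,3)
  proof (induction j rule: dec_induct)
    case (step j)
    then show ?case using incr[of j] \<open>1 \<le> i\<close> by auto
  qed simp
  show ?thesis using mono[of 1 l] mono[of l "2*n"] l lam1 by simp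
qed

theorem theorem4p1:
  fixes n :: nat and lam \<delta> :: "nat \<Rightarrow> real" and a \<kappa> :: real
    and b :: "(nat \<Rightarrow> real) \<Rightarrow> nat \<Rightarrow> real"
    and P :: "real \<Rightarrow> (real \<Rightarrow> nat \<Rightarrow> real) measure"
  assumes n4: "n \<ge> 4"
    and lam1: "lam 1 = 1"
    and lam_pair: "\<forall>i\<in>{1..n}. lam (2*i - 1) = lam (2*i)"
    and lam_incr: "\<forall>i\<in>{1..<n}. lam (2*i) < lam (2*i + 1)"
    and a_pos: "a > 0"
    and \<delta>_range: "\<forall>l\<in>{1..2*n}. -1 < \<delta> l \<and> \<delta> l \<le> 0"
    and \<delta>_pair: "\<forall>i\<in>{1..n}. \<delta> (2*i) = \<delta> (2*i - 1)"
    and b_quad: "\<exists>Q :: nat \<Rightarrow> nat \<Rightarrow> nat \<Rightarrow> real. \<forall>x. \<forall>l\<in>{1..2*n}.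
                   b x l = (\<Sum>j\<in>{1..2*n}. \<Sum>k\<in>{1..2*n}. Q l j k * x j * x k)"
    and b_div: "\<forall>x\<in>Estate n. divergence n b x = 0"
    and b_orth: "\<forall>x\<in>Estate n. inner0 n x (b x) = 0"
    and b_orth_m1: "\<forall>x\<in>Estate n. inner_m1 n lam x (b x) = 0"
    and \<kappa>_range: "0 < \<kappa>" "\<kappa> \<le> 1"
    and P_sol: "\<forall>\<epsilon>>0. stationary_solution n (Lgen n lam a \<delta> b \<kappa> \<epsilon>) (P \<epsilon>)"
    and P_unique: "\<forall>\<epsilon>>0. \<forall>Q. stationary_solution n (Lgen n lam a \<delta> b \<kappa> \<epsilon>) Q \<longrightarrow> Q = P \<epsilon>"
  shows "\<forall>\<eta>>0. \<exists>K. K \<subseteq> CPaths (Cone n lam) \<and>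
           compactin (luc_topology (CPaths (Cone n lam))) K \<and>
           (\<forall>\<epsilon>>0. measure (P \<epsilon>) {\<omega> \<in> space (P \<epsilon>). (\<lambda>t. Wmap n lam (\<omega> t)) \<in> K} \<ge> 1 - \<eta>)"
proof (intro allI impI)
  fix \<eta> :: real assume "\<eta> > 0"
  have lam: "\<forall>l\<in>{1..2*n}. 1 \<le> lam l \<and> lam l \<le> lam (2*n)"
    using eigenvalue_bounds[OF lam1 lam_pair lam_incr] by blast
  then have \<Lambda>: "0 \<le> lam (2*n)" using n4 by force
  have pair: "dissipative_pair n (Lgen n lam a \<delta> b \<kappa> \<epsilon>) (P \<epsilon>)
      (sqnorm n) (quad_drift n lam a \<delta> (\<lambda>_. 1)) (quad_diff n lam a \<delta> (\<lambda>_. 1))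
      (sqnorm_m1 n lam) (quad_drift n lam a \<delta> (\<lambda>l. 1 / lam l)) (quad_diff n lam a \<delta> (\<lambda>l. 1 / lam l))
      (real (2 * n) * a * lam (2*n)) (2 * lam (2*n)) 2 (2 * a * lam (2*n))" if "\<epsilon> \<in> {0<..}" for \<epsilon>
    by (rule dissipative_pair_sqnorm[OF bspec[OF lam] \<Lambda> _ _ lam_pair b_orth b_orth_m1])
       (use that a_pos \<delta>_range P_sol in \<open>auto simp: less_imp_le\<close>)
  have path: "(\<lambda>t. (sqnorm n (\<omega> t), sqnorm_m1 n lam (\<omega> t))) \<in> CPaths (Cone n lam)"
    if "\<omega> \<in> Paths n" for \<omega>
    using Wmap_path_in_CPaths[OF lam that] by (simp add: Wmap_def)
  show "\<exists>K. K \<subseteq> CPaths (Cone n lam) \<and> compactin (luc_topology (CPaths (Cone n lam))) K \<and>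
    (\<forall>\<epsilon>>0. measure (P \<epsilon>) {\<omega> \<in> space (P \<epsilon>). (\<lambda>t. Wmap n lam (\<omega> t)) \<in> K} \<ge> 1 - \<eta>)"
    using dissipative_pair_tightness[where I = "{0<..}" and P = P, OF closed_Cone pair path \<open>\<eta> > 0\<close>]
    unfolding Wmap_def by (simp only: Ball_def greaterThan_iff)
qed

end
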